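(* Suppose the bottom topography is independent of time. Consider the semi-discrete finite volume scheme $$\frac{d}{dt}\boldsymbol U_i=-\frac{\mathcal F_{i+1/2}-\mathcal F_{i-1/2}}{\Delta x}+\boldsymbol S_i$$ for the stochastic Galerkin shallow water equations, with $$\mathcal F_{i+1/2}=\mathcal F^{EC}_{i+1/2}=\begin{pmatrix}\mathcal P(\overline{\boldsymbol h}_{i+1/2})\overline{\boldsymbol u}_{i+1/2}\\ \frac g2\overline{(\mathcal P(\boldsymbol h)\boldsymbol h)}_{i+1/2}+\mathcal P(\overline{\boldsymbol u}_{i+1/2})\mathcal P(\overline{\boldsymbol h}_{i+1/2})\overline{\boldsymbol u}_{i+1/2}\end{pmatrix},$$ $$\boldsymbol S_i=\begin{pmatrix}\boldsymbol 0\\ -\frac{g}{2\Delta x}\left(\mathcal P(\overline{\boldsymbol h}_{i+1/2})[\![\boldsymbol B]\!]_{i+1/2}+\mathcal P(\overline{\boldsymbol h}_{i-1/2})[\![\boldsymbol B]\!]_{i-1/2}\right)\end{pmatrix}.$$ Then this is a well-balanced energy conservative (EC) scheme with local truncation error $\mathcal O(\Delta x^2)$.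
   Context: Polynomial chaos setting. Let $\xi\in\mathbb R^d$ be a random variable with Lebesgue density $\rho$ having finite polynomial moments of all orders, and let $\phi_1,\dots,\phi_K$ (with $\phi_1\equiv1$) be polynomials, orthonormal for $\langle f,g\rangle_\rho=\int f g\rho$. For $\widehat z\in\mathbb R^K$ define the symmetric matrix $\mathcal P(\widehat z)=\sum_{k=1}^K\widehat z_k\mathcal M_k\in\mathbb R^{K\times K}$, $(\mathcal M_k)_{\ell,m}=\langle\phi_k,\phi_\ell\phi_m\rangle_\rho$. SGSWE. With constant $g>0$, state $\widehat U=(\widehat h^\top,\widehat q^\top)^\top\in\mathbb R^{2K}$, bottom coefficients $\widehat B(x)\in\mathbb R^K$ and $\widehat u=\mathcal P(\widehat h)^{-1}\widehat q$, the system is $\widehat U_t+(\widehat F(\widehat U))_x=\widehat S(\widehat U)$ with $$\widehat F(\widehat U)=\begin{pmatrix}\widehat q\\ \mathcal P(\widehat q)\mathcal P(\widehat h)^{-1}\widehat q+\tfrac12 g\mathcal P(\widehat h)\widehat h\end{pmatrix},\qquad \widehat S(\widehat U)=\begin{pmatrix}0\\-g\mathcal P(\widehat h)\widehat{B_x}\end{pmatrix}.$$ Discretization. Uniform mesh with cells $\mathcal I_i=[x_{i-1/2},x_{i+1/2}]$ of length $\Delta x$ and centers $x_i$. Unknowns $\boldsymbol U_i(t)=(\boldsymbol h_i^\top,\boldsymbol q_i^\top)^\top\in\mathbb R^{2K}$ approximate cell averages of $\widehat U$; $\boldsymbol B_i\in\mathbb R^K$ are discrete (cell average) bottom values. Assume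 $\mathcal P(\boldsymbol h_i)$ is positive definite for all $i$; set $\boldsymbol u_i=\mathcal P(\boldsymbol h_i)^{-1}\boldsymbol q_i$. For a cell quantity $\boldsymbol a_i$: $\overline{\boldsymbol a}_{i+1/2}=\frac12(\boldsymbol a_i+\boldsymbol a_{i+1})$ and $[\![\boldsymbol a]\!]_{i+1/2}=\boldsymbol a_{i+1}-\boldsymbol a_i$; in particular $\overline{(\mathcal P(\boldsymbol h)\boldsymbol h)}_{i+1/2}=\frac12(\mathcal P(\boldsymbol h_i)\boldsymbol h_i+\mathcal P(\boldsymbol h_{i+1})\boldsymbol h_{i+1})$. Boundary treatment is not specified; statements are for cells whose neighbors are available (e.g. infinite or periodic mesh). Discrete energy: $\boldsymbol E_i=\frac12(\boldsymbol q_i^\top\boldsymbol u_i+g\|\boldsymbol h_i\|^2)+g\boldsymbol h_i^\top\boldsymbol B_i$. Energy conservative (EC): solutions of the scheme satisfy $\frac{d}{dt}\boldsymbol E_i=-\frac1{\Delta x}(\mathcal H_{i+1/2}-\mathcal H_{i-1/2})$ for all $i$, for some numerical entropy flux $\mathcal H_{i+1/2}$ at the interface $x_{i+1/2}$, i.e. a fixed function of the discrete states and bottom values in cells neighboring that interface. Well-balanced: if $\boldsymbol u_i=\boldsymbol 0$ for all $i$ and $\boldsymbol h_i+\boldsymbol B_i$ is the same vector for all $i$, then $\frac{d}{dt}\boldsymbol h_i=\boldsymbol 0$ and $\frac{d}{dt}\boldsymbol q_i=\boldsymbol 0$ for all $i$ (the stochastic lake-at-rest state is preserved). Local truncation error $\mathcal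 O(\Delta x^2)$: if $(\boldsymbol U_i,\boldsymbol B_i)$ are the exact cell averages of spatially smooth functions $(\widehat U,\widehat B)$ with $\mathcal P(\widehat h)>0$, then $\mathcal F_{i+1/2}-\widehat F(\widehat U)|_{x=x_{i+1/2}}=\mathcal O(\Delta x^2)$ and $\boldsymbol S_i-\widehat S(\widehat U)|_{x=x_i}=\mathcal O(\Delta x^2)$ as $\Delta x\to0$ (constants depending on the smooth functions, locally uniform in $x$). *)

theory Defs
  imports "HOL-Probability.Probability"
begin

section \<open>Polynomial chaos\<close>

text \<open>The basis is a family \<open>\<phi> :: 'k \<Rightarrow> real ^ 'd \<Rightarrow> real\<close> over a finite index type \<open>'k\<close> playing the
  role of \<open>{1,\<dots>,K}\<close>.\<close>

definition ip_rho :: "(real ^ 'd \<Rightarrow> real) \<Rightarrow> (real ^ 'd \<Rightarrow> real) \<Rightarrow> (real ^ 'd \<Rightarrow> real) \<Rightarrow> real" where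
  "ip_rho \<rho> f g = (LINT y|lborel. f y * g y * \<rho> y)"

definition triple_mat ::
  "(real ^ 'd \<Rightarrow> real) \<Rightarrow> ('k::finite \<Rightarrow> real ^ 'd \<Rightarrow> real) \<Rightarrow> 'k \<Rightarrow> real ^ 'k ^ 'k" where
  "triple_mat \<rho> \<phi> k = (\<chi> l m. ip_rho \<rho> (\<phi> k) (\<lambda>y. \<phi> l y * \<phi> m y))"

definition pc_mat ::
  "(real ^ 'd \<Rightarrow> real) \<Rightarrow> ('k::finite \<Rightarrow> real ^ 'd \<Rightarrow> real) \<Rightarrow> real ^ 'k \<Rightarrow> real ^ 'k ^ 'k" where
  "pc_mat \<rho> \<phi> z = (\<Sum>k\<in>UNIV. (z $ k) *\<^sub>R triple_mat \<rho> \<phi> k)"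

definition pos_def :: "real ^ 'n ^ 'n \<Rightarrow> bool" where
  "pos_def A \<longleftrightarrow> transpose A = A \<and> (\<forall>x. x \<noteq> 0 \<longrightarrow> x \<bullet> (A *v x) > 0)"

section \<open>The stochastic Galerkin shallow water equations\<close>

text \<open>A state in \<open>\<real>\<^sup>2\<^sup>K\<close> is a pair \<open>(h, q)\<close>.\<close>

type_synonym 'k sgstate = "(real ^ 'k) \<times> (real ^ 'k)"

definition vel ::
  "(real ^ 'd \<Rightarrow> real) \<Rightarrow> ('k::finite \<Rightarrow> real ^ 'd \<Rightarrow> real) \<Rightarrow> 'k sgstate \<Rightarrow> real ^ 'k" where
  "vel \<rho> \<phi> U = matrix_inv (pc_mat \<rho> \<phi> (fst U)) *v snd U"

definition sg_flux ::
  "(real ^ 'd \<Rightarrow> real) \<Rightarrow> ('k::finite \<Rightarrow> real ^ 'd \<Rightarrow> real) \<Rightarrow> real \<Rightarrow> 'k sgstate \<Rightarrow> 'k sgstate" where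
  "sg_flux \<rho> \<phi> g U = (let h = fst U; q = snd U in
     (q, pc_mat \<rho> \<phi> q *v (matrix_inv (pc_mat \<rho> \<phi> h) *v q) + (g / 2) *\<^sub>R (pc_mat \<rho> \<phi> h *v h)))"

text \<open>The last argument is the value of the spatial derivative of the bottom coefficients.\<close>

definition sg_source ::
  "(real ^ 'd \<Rightarrow> real) \<Rightarrow> ('k::finite \<Rightarrow> real ^ 'd \<Rightarrow> real) \<Rightarrow> real \<Rightarrow> 'k sgstate \<Rightarrow> real ^ 'k
    \<Rightarrow> 'k sgstate" where
  "sg_source \<rho> \<phi> g U Bx = (0, - g *\<^sub>R (pc_mat \<rho> \<phi> (fst U) *v Bx))"

section \<open>Finite volume schemes\<close>

text \<open>Cells are indexed by integers. An interface quantity at index \<open>i\<close> belongs to the right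
  interface \<open>x\<^bsub>i+1/2\<^esub>\<close> of cell \<open>i\<close>; the left interface of cell \<open>i\<close> is thus index \<open>i - 1\<close>.\<close>

definition cell_center :: "real \<Rightarrow> real \<Rightarrow> int \<Rightarrow> real" where
  "cell_center x0 dx i = x0 + of_int i * dx"

definition interface_pt :: "real \<Rightarrow> real \<Rightarrow> int \<Rightarrow> real" where
  "interface_pt x0 dx i = x0 + (of_int i + 1 / 2) * dx"

definition cell_average :: "real \<Rightarrow> real \<Rightarrow> (real \<Rightarrow> 'a::euclidean_space) \<Rightarrow> int \<Rightarrow> 'a" where
  "cell_average x0 dx f i =
     (1 / dx) *\<^sub>R integral {interface_pt x0 dx (i - 1)..interface_pt x0 dx i} f"

definition avg :: "(int \<Rightarrow> 'a::real_vector) \<Rightarrow> int \<Rightarrow> 'a" where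
  "avg a i = (1 / 2) *\<^sub>R (a i + a (i + 1))"

definition jump :: "(int \<Rightarrow> 'a::real_vector) \<Rightarrow> int \<Rightarrow> 'a" where
  "jump a i = a (i + 1) - a i"

text \<open>A mesh is the set \<open>C\<close> of cells carrying data: all integers for an infinite mesh, or for a
  periodic one with the data extended periodically; a finite range of integers for a bounded mesh,
  where nothing is prescribed in the boundary cells.\<close>

definition inner_cells :: "int set \<Rightarrow> int set" where
  "inner_cells C = {i \<in> C. i - 1 \<in> C \<and> i + 1 \<in> C}"

text \<open>A scheme is given by a numerical flux \<open>Fl U i\<close> and a discrete source \<open>Sr dx B U i\<close>. A solution
  \<open>U t i\<close> lives on a set \<open>T\<close> of times, meant to be an interval, with one-sided derivatives at end
  points of \<open>T\<close>. The bottom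
  \<open>B\<close> carries no time argument: it is independent of time.\<close>

type_synonym 'k num_flux = "(int \<Rightarrow> 'k sgstate) \<Rightarrow> int \<Rightarrow> 'k sgstate"
type_synonym 'k num_source =
  "real \<Rightarrow> (int \<Rightarrow> real ^ 'k) \<Rightarrow> (int \<Rightarrow> 'k sgstate) \<Rightarrow> int \<Rightarrow> 'k sgstate"

definition fv_solution ::
  "(real ^ 'd \<Rightarrow> real) \<Rightarrow> ('k::finite \<Rightarrow> real ^ 'd \<Rightarrow> real) \<Rightarrow> 'k num_flux \<Rightarrow> 'k num_source
    \<Rightarrow> real \<Rightarrow> int set \<Rightarrow> real set \<Rightarrow> (int \<Rightarrow> real ^ 'k) \<Rightarrow> (real \<Rightarrow> int \<Rightarrow> 'k sgstate) \<Rightarrow> bool" where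
  "fv_solution \<rho> \<phi> Fl Sr dx C T B U \<longleftrightarrow>
     (\<forall>t\<in>T. \<forall>i\<in>C. pos_def (pc_mat \<rho> \<phi> (fst (U t i)))) \<and>
     (\<forall>t\<in>T. \<forall>i\<in>inner_cells C.
        ((\<lambda>s. U s i) has_vector_derivative
          (- (1 / dx) *\<^sub>R (Fl (U t) i - Fl (U t) (i - 1)) + Sr dx B (U t) i)) (at t within T))"

definition lake_at_rest ::
  "(real ^ 'd \<Rightarrow> real) \<Rightarrow> ('k::finite \<Rightarrow> real ^ 'd \<Rightarrow> real) \<Rightarrow> int set
    \<Rightarrow> (int \<Rightarrow> real ^ 'k) \<Rightarrow> (int \<Rightarrow> 'k sgstate) \<Rightarrow> bool" where
  "lake_at_rest \<rho> \<phi> C B U \<longleftrightarrow>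
     (\<forall>i\<in>C. vel \<rho> \<phi> (U i) = 0) \<and> (\<exists>w. \<forall>i\<in>C. fst (U i) + B i = w)"

text \<open>The second conjunct says that a lake at rest, kept constant in time, solves the scheme; it
  keeps the definition from depending on the existence of solutions through such a state.\<close>

definition well_balanced ::
  "(real ^ 'd \<Rightarrow> real) \<Rightarrow> ('k::finite \<Rightarrow> real ^ 'd \<Rightarrow> real) \<Rightarrow> 'k num_flux \<Rightarrow> 'k num_source \<Rightarrow> bool" where
  "well_balanced \<rho> \<phi> Fl Sr \<longleftrightarrow>
     (\<forall>dx>0. \<forall>C T B U. fv_solution \<rho> \<phi> Fl Sr dx C T B U \<longrightarrow>
        (\<forall>t\<in>T. lake_at_rest \<rho> \<phi> C B (U t) \<longrightarrow>
          (\<forall>i\<in>inner_cells C.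
             ((\<lambda>s. fst (U s i)) has_vector_derivative 0) (at t within T) \<and>
             ((\<lambda>s. snd (U s i)) has_vector_derivative 0) (at t within T)))) \<and>
     (\<forall>dx>0. \<forall>C B U0. (\<forall>i\<in>C. pos_def (pc_mat \<rho> \<phi> (fst (U0 i)))) \<and> lake_at_rest \<rho> \<phi> C B U0 \<longrightarrow>
        fv_solution \<rho> \<phi> Fl Sr dx C UNIV B (\<lambda>t. U0))"

definition energy ::
  "(real ^ 'd \<Rightarrow> real) \<Rightarrow> ('k::finite \<Rightarrow> real ^ 'd \<Rightarrow> real) \<Rightarrow> real \<Rightarrow> 'k sgstate \<Rightarrow> real ^ 'k
    \<Rightarrow> real" where
  "energy \<rho> \<phi> g U b =
     (1 / 2) * (snd U \<bullet> vel \<rho> \<phi> U + g * (norm (fst U))\<^sup>2) + g * (fst U \<bullet> b)"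

text \<open>The numerical entropy flux \<open>H\<close> is one function of the states and bottom values in the two
  cells sharing the interface, chosen before mesh, data and solution.\<close>

definition energy_conservative ::
  "(real ^ 'd \<Rightarrow> real) \<Rightarrow> ('k::finite \<Rightarrow> real ^ 'd \<Rightarrow> real) \<Rightarrow> real
    \<Rightarrow> 'k num_flux \<Rightarrow> 'k num_source \<Rightarrow> bool" where
  "energy_conservative \<rho> \<phi> g Fl Sr \<longleftrightarrow>
     (\<exists>H :: 'k sgstate \<Rightarrow> real ^ 'k \<Rightarrow> 'k sgstate \<Rightarrow> real ^ 'k \<Rightarrow> real.
        \<forall>dx>0. \<forall>C T B U. fv_solution \<rho> \<phi> Fl Sr dx C T B U \<longrightarrow>
          (\<forall>t\<in>T. \<forall>i\<in>inner_cells C.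
             ((\<lambda>s. energy \<rho> \<phi> g (U s i) (B i)) has_real_derivative
               - (1 / dx) * (H (U t i) (B i) (U t (i + 1)) (B (i + 1))
                             - H (U t (i - 1)) (B (i - 1)) (U t i) (B i))) (at t within T)))"

text \<open>Infinite differentiability, used for open \<open>X\<close> only.\<close>

definition smooth_on :: "real set \<Rightarrow> (real \<Rightarrow> 'a::real_normed_vector) \<Rightarrow> bool" where
  "smooth_on X f \<longleftrightarrow>
     (\<forall>n. ((\<lambda>f' x. vector_derivative f' (at x)) ^^ n) f differentiable_on X)"

text \<open>Local uniformity: on each compact subset of the spatial domain \<open>X\<close>, one constant serves all
  sufficiently fine uniform meshes, whatever their origin \<open>x0\<close>. For such meshes the cells next to
  points of the compact set lie inside \<open>X\<close>.\<close>

definition second_order_truncation ::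
  "(real ^ 'd \<Rightarrow> real) \<Rightarrow> ('k::finite \<Rightarrow> real ^ 'd \<Rightarrow> real) \<Rightarrow> real
    \<Rightarrow> 'k num_flux \<Rightarrow> 'k num_source \<Rightarrow> bool" where
  "second_order_truncation \<rho> \<phi> g Fl Sr \<longleftrightarrow>
     (\<forall>X (Uh :: real \<Rightarrow> 'k sgstate) (Bh :: real \<Rightarrow> real ^ 'k).
        open X \<and> smooth_on X Uh \<and> smooth_on X Bh \<and>
        (\<forall>x\<in>X. pos_def (pc_mat \<rho> \<phi> (fst (Uh x)))) \<longrightarrow>
        (\<forall>Y. compact Y \<and> Y \<subseteq> X \<longrightarrow>
          (\<exists>c \<delta>. \<delta> > 0 \<and>
            (\<forall>x0 dx i. 0 < dx \<and> dx < \<delta> \<longrightarrow>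
              (let U = cell_average x0 dx Uh; B = cell_average x0 dx Bh;
                   y = interface_pt x0 dx i; z = cell_center x0 dx i in
                (y \<in> Y \<longrightarrow> norm (Fl U i - sg_flux \<rho> \<phi> g (Uh y)) \<le> c * dx\<^sup>2) \<and>
                (z \<in> Y \<longrightarrow> norm (Sr dx B U i
                    - sg_source \<rho> \<phi> g (Uh z) (vector_derivative Bh (at z))) \<le> c * dx\<^sup>2))))))"

section \<open>The scheme\<close>

definition flux_EC ::
  "(real ^ 'd \<Rightarrow> real) \<Rightarrow> ('k::finite \<Rightarrow> real ^ 'd \<Rightarrow> real) \<Rightarrow> real \<Rightarrow> 'k num_flux" where
  "flux_EC \<rho> \<phi> g U i =
     (let h = (\<lambda>j. fst (U j)); u = (\<lambda>j. vel \<rho> \<phi> (U j)) in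
       (pc_mat \<rho> \<phi> (avg h i) *v avg u i,
        (g / 2) *\<^sub>R avg (\<lambda>j. pc_mat \<rho> \<phi> (h j) *v h j) i
          + pc_mat \<rho> \<phi> (avg u i) *v (pc_mat \<rho> \<phi> (avg h i) *v avg u i)))"

definition source_EC ::
  "(real ^ 'd \<Rightarrow> real) \<Rightarrow> ('k::finite \<Rightarrow> real ^ 'd \<Rightarrow> real) \<Rightarrow> real \<Rightarrow> 'k num_source" where
  "source_EC \<rho> \<phi> g dx B U i =
     (let h = (\<lambda>j. fst (U j)) in
       (0, - (g / (2 * dx)) *\<^sub>R (pc_mat \<rho> \<phi> (avg h i) *v jump B i
                                + pc_mat \<rho> \<phi> (avg h (i - 1)) *v jump B (i - 1))))"

end

theory Submission imports Defs begin

text \<open>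
  Everything rests on the bilinear product \<open>P(a)b\<close> being symmetric and each \<open>P(a)\<close> being self-adjoint.
  This gives \<open>P(avg a) [[a]] = [[P(a)a]]/2\<close>, which balances pressure against the source for a lake at
  rest and is the discrete product rule behind energy conservation.

  Since \<open>P(h)u = q\<close>, one has \<open>q(s) \<bullet> u(s) - q(t) \<bullet> u(t) =
  (q(s) - q(t)) \<bullet> (u(s) + u(t)) - P(h(s) - h(t)) u(s) \<bullet> u(t)\<close>, so the energy can be differentiated
  using only continuity of \<open>u\<close>.

  For the truncation error, quantities on the two sides of a point have expansions
  \<open>a0 \<plusminus> \<epsilon> a1 + O(\<epsilon>\<^sup>2)\<close>, uniformly on compact sets. Such expansions are preserved by linear
  and bilinear maps and, by uniform coercivity of \<open>P(h)\<close>, by solving \<open>P(h)u = q\<close>; averaging the two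
  sides cancels the first-order term.
\<close>

section \<open>The Galerkin product\<close>

lemma pc_mat_nth:
  "pc_mat \<rho> \<phi> a $ l $ m = (\<Sum>k\<in>UNIV. a $ k * ip_rho \<rho> (\<phi> k) (\<lambda>y. \<phi> l y * \<phi> m y))"
  by (simp add: pc_mat_def triple_mat_def)

lemma transpose_pc_mat: "transpose (pc_mat \<rho> \<phi> a) = pc_mat \<rho> \<phi> a"
  by (simp add: vec_eq_iff transpose_def pc_mat_nth mult.commute)

text \<open>The triple products of the basis are symmetric in all three indices, so exchanging the
  two summations exchanges the roles of \<open>a\<close> and \<open>b\<close>.\<close>

lemma pc_mat_mult_commute: "pc_mat \<rho> \<phi> a *v b = pc_mat \<rho> \<phi> b *v a"
proof -
  have "(\<Sum>m\<in>UNIV. (\<Sum>k\<in>UNIV. a $ k * ip_rho \<rho> (\<phi> k) (\<lambda>y. \<phi> l y * \<phi> m y)) * b $ m)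
     = (\<Sum>m\<in>UNIV. (\<Sum>k\<in>UNIV. b $ k * ip_rho \<rho> (\<phi> k) (\<lambda>y. \<phi> l y * \<phi> m y)) * a $ m)" for l
    unfolding sum_distrib_right
    by (subst sum.swap) (simp add: ip_rho_def mult_ac)
  then show ?thesis
    by (simp add: vec_eq_iff matrix_vector_mult_def pc_mat_nth)
qed

lemma inner_pc_mat_commute: "x \<bullet> (pc_mat \<rho> \<phi> a *v y) = (pc_mat \<rho> \<phi> a *v x) \<bullet> y"
  by (metis dot_lmul_matrix transpose_matrix_vector transpose_pc_mat)

text \<open>Commutativity transfers linearity from the vector argument to the matrix argument;
  boundedness is then automatic in finite dimension. This makes the limit and continuity rules for
  bilinear maps available.\<close>

lemma bounded_bilinear_pc_mat:
  fixes \<phi> :: "'k::finite \<Rightarrow> real ^ 'd \<Rightarrow> real"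
  shows "bounded_bilinear (\<lambda>a b. pc_mat \<rho> \<phi> a *v b)"
proof -
  have lin: "linear (\<lambda>b. pc_mat \<rho> \<phi> a *v b)" for a
    by simp
  then have "linear (\<lambda>a. pc_mat \<rho> \<phi> a *v b)" for b
    by (subst pc_mat_mult_commute) (rule lin)
  with lin show ?thesis
    unfolding bilinear_conv_bounded_bilinear[symmetric] bilinear_def by blast
qed

interpretation pc: bounded_bilinear "\<lambda>a b. pc_mat \<rho> \<phi> a *v b" for \<rho> \<phi>
  by (rule bounded_bilinear_pc_mat)

text \<open>As in \<open>(a + b)(b - a) = b^2 - a^2\<close>: commutativity cancels the mixed
  terms.\<close>

lemma pc_mat_mult_jump:
  "pc_mat \<rho> \<phi> ((1/2) *\<^sub>R (a + b)) *v (b - a)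
     = (1/2) *\<^sub>R (pc_mat \<rho> \<phi> b *v b - pc_mat \<rho> \<phi> a *v a)"
  by (simp add: pc.scaleR_left pc.add_left pc.diff_right pc_mat_mult_commute[of _ _ a b] algebra_simps)

section \<open>Coercive matrices\<close>

text \<open>Positive definiteness with an explicit constant, so that one \<open>\<alpha>\<close> can
  bound the inverses of a whole family of matrices.\<close>

definition coercive :: "real \<Rightarrow> real ^ 'n ^ 'n \<Rightarrow> bool" where
  "coercive \<alpha> A \<longleftrightarrow> \<alpha> > 0 \<and> (\<forall>x. \<alpha> * (norm x)\<^sup>2 \<le> x \<bullet> (A *v x))"

lemma coercive_norm_le:
  assumes "coercive \<alpha> A"
  shows "norm x \<le> norm (A *v x) / \<alpha>"
proof (cases "x = 0")
  case False
  have "norm x * (\<alpha> * norm x) \<le> x \<bullet> (A *v x)"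
    using assms by (simp add: coercive_def power2_eq_square mult_ac)
  also have "\<dots> \<le> norm x * norm (A *v x)"
    by (rule norm_cauchy_schwarz)
  finally have "\<alpha> * norm x \<le> norm (A *v x)"
    using False by simp
  then show ?thesis
    using assms by (simp add: coercive_def field_simps)
qed simp

text \<open>\<open>matrix_inv\<close> is defined by choice, so its equations require invertibility
  first; for a square matrix this follows from a trivial kernel.\<close>

lemma mult_matrix_inv:
  fixes A :: "real ^ 'n ^ 'n"
  assumes "\<And>x. A *v x = 0 \<Longrightarrow> x = 0"
  shows "A *v (matrix_inv A *v y) = y" "matrix_inv A *v (A *v y) = y"
proof -
  have "invertible A"
    using assms invertible_left_inverse matrix_left_invertible_ker by blast
  then have "A ** matrix_inv A = mat 1 \<and> matrix_inv A ** A = mat 1"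
    unfolding invertible_def matrix_inv_def by (rule someI_ex)
  then show "A *v (matrix_inv A *v y) = y" "matrix_inv A *v (A *v y) = y"
    by (simp_all add: matrix_vector_mul_assoc)
qed

lemma coercive_mult_matrix_inv:
  assumes "coercive \<alpha> A"
  shows "A *v (matrix_inv A *v y) = y" "matrix_inv A *v (A *v y) = y"
proof -
  have "x = 0" if "A *v x = 0" for x
    using coercive_norm_le[OF assms, of x] that by simp
  then show "A *v (matrix_inv A *v y) = y" "matrix_inv A *v (A *v y) = y"
    using mult_matrix_inv[of A] by blast+
qed

lemma pos_def_mult_matrix_inv:
  assumes "pos_def A"
  shows "A *v (matrix_inv A *v y) = y"
proof (rule mult_matrix_inv)
  fix x assume "A *v x = 0"
  then show "x = 0" using assms unfolding pos_def_def by (metis inner_zero_right less_irrefl)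
qed

text \<open>The quadratic form attains a positive minimum on the compact product of \<open>Y\<close>
  with the unit sphere; homogeneity extends the bound to all vectors.\<close>

lemma pos_def_coercive_uniform:
  fixes A :: "'a::topological_space \<Rightarrow> real ^ 'n ^ 'n"
  assumes "compact Y" and "\<And>y. y \<in> Y \<Longrightarrow> pos_def (A y)"
    and "continuous_on (Y \<times> UNIV) (\<lambda>p. A (fst p) *v snd p)"
  obtains \<alpha> where "\<And>y. y \<in> Y \<Longrightarrow> coercive \<alpha> (A y)"
proof (cases "Y = {}")
  case False
  let ?K = "Y \<times> sphere (0 :: real ^ 'n) 1"
  have "compact ?K"
    using assms(1) by (intro compact_Times compact_sphere)
  \<comment> \<open>Any coordinate vector shows that the sphere is nonempty, as the existence of a
    minimum requires.\<close>
  moreover have "axis undefined 1 \<in> sphere (0 :: real ^ 'n) 1"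
    by (simp add: norm_axis_1)
  then have "?K \<noteq> {}" using False by blast
  moreover have "continuous_on ?K (\<lambda>p. snd p \<bullet> (A (fst p) *v snd p))"
    by (intro continuous_intros continuous_on_subset[OF assms(3)]) auto
  ultimately obtain p where p: "p \<in> ?K"
      "\<forall>p'\<in>?K. snd p \<bullet> (A (fst p) *v snd p) \<le> snd p' \<bullet> (A (fst p') *v snd p')"
    using continuous_attains_inf by blast
  define \<alpha> where "\<alpha> = snd p \<bullet> (A (fst p) *v snd p)"
  have "snd p \<noteq> 0" using p(1) by auto
  then have "\<alpha> > 0"
    using assms(2)[of "fst p"] p(1) unfolding \<alpha>_def pos_def_def by (metis mem_Times_iff)
  moreover have "\<alpha> * (norm x)\<^sup>2 \<le> x \<bullet> (A y *v x)" if "y \<in> Y" for x y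
  proof (cases "x = 0")
    case False
    then have "(y, sgn x) \<in> ?K"
      using that by (simp add: norm_sgn)
    then have "\<alpha> \<le> sgn x \<bullet> (A y *v sgn x)"
      using p(2) \<alpha>_def by fastforce
    also have "\<dots> = (x \<bullet> (A y *v x)) / (norm x)\<^sup>2"
      by (simp add: sgn_div_norm matrix_vector_mult_scaleR power2_eq_square divide_inverse)
    finally show ?thesis
      using False by (simp add: field_simps)
  qed simp
  ultimately show thesis
    using that unfolding coercive_def by blast
qed (use that in blast)

text \<open>The constant family over a one-point space reduces this to the uniform version.\<close>

lemma pos_def_coercive:
  assumes "pos_def A"
  obtains \<alpha> where "coercive \<alpha> A"
proof -
  have "continuous_on ({0::real} \<times> UNIV) (\<lambda>p. A *v snd p)"
    by (intro linear_continuous_on_compose[OF _ matrix_vector_mul_linear] continuous_intros)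
  then show thesis
    using pos_def_coercive_uniform[of "{0::real}" "\<lambda>_. A"] assms that by auto
qed

text \<open>Coercivity is stable: replacing \<open>h0\<close> by \<open>h\<close> changes the
  quadratic form by at most \<open>K * norm (h - h0) * (norm x)^2\<close>, which eventually costs no
  more than half of \<open>\<alpha>\<close>.\<close>

lemma eventually_coercive_pc_mat:
  fixes h h0 :: "'a \<Rightarrow> real ^ 'k::finite"
  assumes "eventually (\<lambda>p. coercive \<alpha> (pc_mat \<rho> \<phi> (h0 p))) F"
    and "((\<lambda>p. h p - h0 p) \<longlongrightarrow> 0) F"
  shows "eventually (\<lambda>p. coercive (\<alpha> / 2) (pc_mat \<rho> \<phi> (h p))) F"
proof -
  obtain K where K: "K > 0" "\<And>a b. norm (pc_mat \<rho> \<phi> a *v b) \<le> norm a * norm b * K"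
    using pc.pos_bounded[of \<rho> \<phi>] by blast
  show ?thesis
  proof (cases "\<alpha> > 0")
    case True
    have "eventually (\<lambda>p. norm (h p - h0 p) < \<alpha> / (2 * K)) F"
      using tendstoD[OF assms(2), of "\<alpha> / (2 * K)"] True K(1) by (simp add: dist_norm)
    with assms(1) show ?thesis
    proof eventually_elim
      case (elim p)
      have "\<alpha> / 2 * (norm x)\<^sup>2 \<le> x \<bullet> (pc_mat \<rho> \<phi> (h p) *v x)" for x
      proof -
        have "\<bar>x \<bullet> (pc_mat \<rho> \<phi> (h p - h0 p) *v x)\<bar> \<le> norm x * (norm (h p - h0 p) * norm x * K)"
          by (rule order_trans[OF Cauchy_Schwarz_ineq2]) (intro mult_left_mono K(2) norm_ge_zero)
        also have "\<dots> = (norm (h p - h0 p) * K) * (norm x)\<^sup>2"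
          by (simp add: power2_eq_square)
        also have "\<dots> \<le> \<alpha> / 2 * (norm x)\<^sup>2"
          using elim(2) K(1) by (intro mult_right_mono) (simp_all add: field_simps)
        finally show ?thesis
          using elim(1) unfolding coercive_def
          by (simp add: pc.diff_left inner_diff_right) (smt (verit) field_sum_of_halves)
      qed
      with True show ?case by (simp add: coercive_def)
    qed
  next
    \<comment> \<open>Coercivity includes positivity of its constant, so here the premise says that
      \<open>False\<close> holds eventually and every conclusion follows.\<close>
    case False
    then have "\<not> coercive \<alpha> (pc_mat \<rho> \<phi> (h0 p))" for p
      by (simp add: coercive_def)
    with assms(1) show ?thesis by (auto elim: eventually_mono)
  qed
qed

lemma pc_mat_vel:
  assumes "pos_def (pc_mat \<rho> \<phi> (fst U))"
  shows "pc_mat \<rho> \<phi> (fst U) *v vel \<rho> \<phi> U = snd U"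
  unfolding vel_def by (rule pos_def_mult_matrix_inv[OF assms])

section \<open>Well-balancedness\<close>

text \<open>At zero velocity only the averaged pressure survives in the flux. Since
  \<open>B = w - h\<close>, each jump of \<open>B\<close> is minus the jump of \<open>h\<close>, and
  the source becomes a pressure difference as well.\<close>

lemma flux_source_lake_at_rest:
  assumes pd: "\<forall>i\<in>C. pos_def (pc_mat \<rho> \<phi> (fst (U i)))"
    and lake: "lake_at_rest \<rho> \<phi> C B U" and i: "i \<in> inner_cells C"
  shows "- (1 / dx) *\<^sub>R (flux_EC \<rho> \<phi> g U i - flux_EC \<rho> \<phi> g U (i - 1)) + source_EC \<rho> \<phi> g dx B U i = 0"
proof -
  obtain w where w: "\<forall>i\<in>C. fst (U i) + B i = w" and u: "\<forall>i\<in>C. vel \<rho> \<phi> (U i) = 0"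
    using lake unfolding lake_at_rest_def by blast
  have C: "i \<in> C" "i - 1 \<in> C" "i + 1 \<in> C"
    using i by (auto simp: inner_cells_def)
  define f where "f j = pc_mat \<rho> \<phi> (fst (U j)) *v fst (U j)" for j
  have B: "B j = w - fst (U j)" if "j \<in> C" for j
    using w that by (auto simp: algebra_simps)
  have src: "pc_mat \<rho> \<phi> (avg (\<lambda>j. fst (U j)) j) *v jump B j = - (1/2) *\<^sub>R (f (j + 1) - f j)"
    if "j \<in> C" "j + 1 \<in> C" for j
  proof -
    have "jump B j = - (fst (U (j + 1)) - fst (U j))"
      using B[OF that(1)] B[OF that(2)] by (simp add: jump_def)
    then show ?thesis
      using pc_mat_mult_jump[of \<rho> \<phi> "fst (U j)" "fst (U (j + 1))"]
      by (simp only: avg_def f_def pc.minus_right scaleR_minus_left)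
  qed
  \<comment> \<open>The values \<open>f i\<close> from the two faces cancel, leaving the same
    difference between the outer neighbors as in the flux.\<close>
  have s: "source_EC \<rho> \<phi> g dx B U i = (0, (g / (4 * dx)) *\<^sub>R (f (i + 1) - f (i - 1)))"
  proof -
    have "- (1/2) *\<^sub>R (f (i + 1) - f i) + - (1/2) *\<^sub>R (f i - f (i - 1)) = - (1/2) *\<^sub>R (f (i + 1) - f (i - 1))"
      by (simp add: algebra_simps)
    then show ?thesis
      using src[of i] src[of "i - 1"] C by (simp add: source_EC_def Let_def)
  qed
  have fl: "flux_EC \<rho> \<phi> g U j = (0, (g / 4) *\<^sub>R (f j + f (j + 1)))" if "j \<in> C" "j + 1 \<in> C" for j
    using u that by (simp add: flux_EC_def Let_def avg_def f_def)
  show ?thesis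
    using fl[of i] fl[of "i - 1"] C s
    by (simp add: zero_prod_def flip: scaleR_diff_right scaleR_add_right)
qed

lemma well_balanced_EC: "well_balanced \<rho> \<phi> (flux_EC \<rho> \<phi> g) (source_EC \<rho> \<phi> g)"
proof -
  have "((\<lambda>s. fst (U s i)) has_vector_derivative 0) (at t within T) \<and>
        ((\<lambda>s. snd (U s i)) has_vector_derivative 0) (at t within T)"
    if "fv_solution \<rho> \<phi> (flux_EC \<rho> \<phi> g) (source_EC \<rho> \<phi> g) dx C T B U" "t \<in> T"
      "lake_at_rest \<rho> \<phi> C B (U t)" "i \<in> inner_cells C" for dx C T B U t i
  proof -
    have "((\<lambda>s. U s i) has_vector_derivative 0) (at t within T)"
      using that flux_source_lake_at_rest[of C \<rho> \<phi> "U t" B i dx g]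
      unfolding fv_solution_def by metis
    from bounded_linear.has_vector_derivative[OF bounded_linear_fst this]
      bounded_linear.has_vector_derivative[OF bounded_linear_snd this]
    show ?thesis by simp
  qed
  moreover have "fv_solution \<rho> \<phi> (flux_EC \<rho> \<phi> g) (source_EC \<rho> \<phi> g) dx C UNIV B (\<lambda>t. U0)"
    if "\<forall>i\<in>C. pos_def (pc_mat \<rho> \<phi> (fst (U0 i)))" "lake_at_rest \<rho> \<phi> C B U0" for dx C B U0
    using that flux_source_lake_at_rest[OF that] by (simp add: fv_solution_def)
  ultimately show ?thesis
    unfolding well_balanced_def by blast
qed

section \<open>Energy conservation\<close>

text \<open>Applying \<open>P(h(s))\<close> to the velocity error gives the residual
  \<open>r s\<close>, which tends to zero; coercivity near the limit state bounds the error by the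
  residual.\<close>

lemma tendsto_vel:
  assumes pd: "eventually (\<lambda>s. pos_def (pc_mat \<rho> \<phi> (fst (V s)))) F"
    and pd0: "pos_def (pc_mat \<rho> \<phi> (fst V0))" and V: "(V \<longlongrightarrow> V0) F"
  shows "((\<lambda>s. vel \<rho> \<phi> (V s)) \<longlongrightarrow> vel \<rho> \<phi> V0) F"
proof -
  obtain \<alpha> where \<alpha>: "coercive \<alpha> (pc_mat \<rho> \<phi> (fst V0))"
    using pos_def_coercive[OF pd0] .
  have "((\<lambda>s. fst (V s) - fst V0) \<longlongrightarrow> 0) F"
    using tendsto_fst[OF V] by (simp add: LIM_zero_iff)
  then have ev: "eventually (\<lambda>s. coercive (\<alpha> / 2) (pc_mat \<rho> \<phi> (fst (V s)))) F"
    by (intro eventually_coercive_pc_mat[where ?h0.0 = "\<lambda>_. fst V0"]) (simp_all add: \<alpha>)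
  define r where "r s = snd (V s) - pc_mat \<rho> \<phi> (fst (V s)) *v vel \<rho> \<phi> V0" for s
  have "(r \<longlongrightarrow> snd V0 - pc_mat \<rho> \<phi> (fst V0) *v vel \<rho> \<phi> V0) F"
    unfolding r_def by (intro tendsto_intros pc.tendsto V)
  then have "(r \<longlongrightarrow> 0) F"
    by (simp add: pc_mat_vel[OF pd0])
  then have "((\<lambda>s. norm (r s) / (\<alpha> / 2)) \<longlongrightarrow> 0) F"
    by (intro tendsto_divide_zero tendsto_norm_zero)
  moreover have "eventually (\<lambda>s. norm (vel \<rho> \<phi> (V s) - vel \<rho> \<phi> V0) \<le> norm (r s) / (\<alpha> / 2)) F"
    using ev pd
  proof eventually_elim
    case (elim s)
    show ?case
      using coercive_norm_le[OF elim(1), of "vel \<rho> \<phi> (V s) - vel \<rho> \<phi> V0"]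
      by (simp add: r_def pc.diff_right pc_mat_vel[OF elim(2)])
  qed
  ultimately have "((\<lambda>s. vel \<rho> \<phi> (V s) - vel \<rho> \<phi> V0) \<longlongrightarrow> 0) F"
    by (rule Lim_null_comparison[rotated])
  then show ?thesis by (simp add: LIM_zero_iff)
qed

text \<open>The difference quotient is rewritten so that only \<open>V\<close> is differenced while
  the velocity enters through its values; continuity of the velocity then suffices for the
  limit.\<close>

lemma has_real_derivative_momentum_vel:
  assumes pd: "\<And>s. s \<in> T \<Longrightarrow> pos_def (pc_mat \<rho> \<phi> (fst (V s)))" and t: "t \<in> T"
    and V: "(V has_vector_derivative D) (at t within T)"
  shows "((\<lambda>s. snd (V s) \<bullet> vel \<rho> \<phi> (V s)) has_real_derivative
    2 * (snd D \<bullet> vel \<rho> \<phi> (V t)) - (pc_mat \<rho> \<phi> (fst D) *v vel \<rho> \<phi> (V t)) \<bullet> vel \<rho> \<phi> (V t))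
    (at t within T)"
proof -
  let ?u = "\<lambda>s. vel \<rho> \<phi> (V s)" and ?h = "\<lambda>s. fst (V s)" and ?q = "\<lambda>s. snd (V s)"
  let ?F = "at t within T"
  have "continuous (at t within T) V"
    using V by (rule has_vector_derivative_continuous)
  then have "(V \<longlongrightarrow> V t) ?F"
    by (simp add: continuous_within)
  \<comment> \<open>Within this filter \<open>s\<close> lies in \<open>T\<close> and differs from
    \<open>t\<close>, so positive definiteness is available and division by \<open>s - t\<close> is
    legitimate.\<close>
  moreover have evT: "eventually (\<lambda>s. s \<in> T \<and> s \<noteq> t) ?F"
    by (simp add: eventually_at_filter)
  then have "eventually (\<lambda>s. pos_def (pc_mat \<rho> \<phi> (?h s))) ?F"
    by (rule eventually_mono) (use pd in blast)
  ultimately have u: "(?u \<longlongrightarrow> ?u t) ?F"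
    using pd[OF t] by (intro tendsto_vel)
  have V': "((\<lambda>s. (1 / (s - t)) *\<^sub>R (V s - V t)) \<longlongrightarrow> D) ?F"
  proof -
    have "((\<lambda>s. norm (V s - V t - (s - t) *\<^sub>R D) / norm (s - t)) \<longlongrightarrow> 0) ?F"
      using V unfolding has_vector_derivative_def has_derivative_iff_norm by blast
    moreover have "eventually (\<lambda>s. norm ((1 / (s - t)) *\<^sub>R (V s - V t) - D)
        \<le> norm (V s - V t - (s - t) *\<^sub>R D) / norm (s - t)) ?F"
      using evT
    proof eventually_elim
      case (elim s)
      then have "(1 / (s - t)) *\<^sub>R (V s - V t) - D = (1 / (s - t)) *\<^sub>R (V s - V t - (s - t) *\<^sub>R D)"
        by (simp add: scaleR_diff_right)
      then show ?case by simp
    qed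
    ultimately have "((\<lambda>s. (1 / (s - t)) *\<^sub>R (V s - V t) - D) \<longlongrightarrow> 0) ?F"
      by (rule Lim_null_comparison[rotated])
    then show ?thesis by (simp add: LIM_zero_iff)
  qed
  have lim: "((\<lambda>s. snd ((1 / (s - t)) *\<^sub>R (V s - V t)) \<bullet> (?u s + ?u t)
      - (pc_mat \<rho> \<phi> (fst ((1 / (s - t)) *\<^sub>R (V s - V t))) *v ?u s) \<bullet> ?u t) \<longlongrightarrow>
      snd D \<bullet> (?u t + ?u t) - (pc_mat \<rho> \<phi> (fst D) *v ?u t) \<bullet> ?u t) ?F"
    by (intro tendsto_intros pc.tendsto V' u)
  have eq: "snd ((1 / (s - t)) *\<^sub>R (V s - V t)) \<bullet> (?u s + ?u t)
      - (pc_mat \<rho> \<phi> (fst ((1 / (s - t)) *\<^sub>R (V s - V t))) *v ?u s) \<bullet> ?u t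
      = (?q s \<bullet> ?u s - ?q t \<bullet> ?u t) / (s - t)" if s: "s \<in> T" for s
  proof -
    \<comment> \<open>Self-adjointness moves \<open>P(h(t))\<close> onto \<open>u(t)\<close>, so
      \<open>P(h) u = q\<close> can be used at both times.\<close>
    have "(pc_mat \<rho> \<phi> (?h s - ?h t) *v ?u s) \<bullet> ?u t = ?q s \<bullet> ?u t - ?q t \<bullet> ?u s"
      by (simp add: pc.diff_left inner_diff_left pc_mat_vel pd s t inner_pc_mat_commute[symmetric]
          inner_commute[of "?u s"])
    then have "(?q s - ?q t) \<bullet> (?u s + ?u t) - (pc_mat \<rho> \<phi> (?h s - ?h t) *v ?u s) \<bullet> ?u t
      = ?q s \<bullet> ?u s - ?q t \<bullet> ?u t"
      by (simp add: inner_diff_left inner_add_right)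
    then show ?thesis
      by (simp add: pc.scaleR_left diff_divide_distrib[symmetric])
  qed
  have "((\<lambda>s. (?q s \<bullet> ?u s - ?q t \<bullet> ?u t) / (s - t)) \<longlongrightarrow>
      snd D \<bullet> (?u t + ?u t) - (pc_mat \<rho> \<phi> (fst D) *v ?u t) \<bullet> ?u t) ?F"
    by (rule Lim_transform_eventually[OF lim], rule eventually_mono[OF evT]) (use eq in blast)
  then show ?thesis
    by (simp only: has_field_derivative_iff inner_add_right mult_2)
qed

text \<open>With entropy variables \<open>v = (g(h + b) - P(u)u/2, u)\<close> and flux \<open>(m, p)\<close>, the energy balance of a
  cell contains the right-face term \<open>v \<bullet> (m, p) + g/2 u \<bullet> P(hm)[[b]]\<close> and the left-face term
  \<open>v \<bullet> (m, p) - g/2 u \<bullet> P(hm)[[b]]\<close>. These are not equal across a face, but their mismatch is the jump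
  of the potential \<open>g/2 u \<bullet> P(h)h\<close>; subtracting the potential yields a single-valued flux.\<close>

definition energy_flux_EC ::
  "(real ^ 'd \<Rightarrow> real) \<Rightarrow> ('k::finite \<Rightarrow> real ^ 'd \<Rightarrow> real) \<Rightarrow> real
    \<Rightarrow> 'k sgstate \<Rightarrow> real ^ 'k \<Rightarrow> 'k sgstate \<Rightarrow> real ^ 'k \<Rightarrow> real" where
  "energy_flux_EC \<rho> \<phi> g Ul bl Ur br =
    (let hl = fst Ul; ul = vel \<rho> \<phi> Ul; hr = fst Ur; ur = vel \<rho> \<phi> Ur;
         hm = (1/2) *\<^sub>R (hl + hr); um = (1/2) *\<^sub>R (ul + ur); m = pc_mat \<rho> \<phi> hm *v um;
         p = (g / 4) *\<^sub>R (pc_mat \<rho> \<phi> hl *v hl + pc_mat \<rho> \<phi> hr *v hr) + pc_mat \<rho> \<phi> um *v m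
     in (g *\<^sub>R (hl + bl) - (1/2) *\<^sub>R (pc_mat \<rho> \<phi> ul *v ul)) \<bullet> m + ul \<bullet> p
        + g / 2 * (ul \<bullet> (pc_mat \<rho> \<phi> hm *v (br - bl))) - g / 2 * (ul \<bullet> (pc_mat \<rho> \<phi> hl *v hl)))"

text \<open>The definition reads the flux from the left state; this form reads it from the right
  state. A cell can thus express the fluxes at both of its faces through its own state. The two
  forms agree by discrete product rules for the kinetic, bottom and pressure terms.\<close>

lemma energy_flux_EC_right:
  fixes \<rho> :: "real ^ 'd \<Rightarrow> real" and \<phi> :: "'k::finite \<Rightarrow> real ^ 'd \<Rightarrow> real"
  defines "P \<equiv> pc_mat \<rho> \<phi>"
  assumes "hl = fst Ul" "ul = vel \<rho> \<phi> Ul" "hr = fst Ur" "ur = vel \<rho> \<phi> Ur"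
    "hm = (1/2) *\<^sub>R (hl + hr)" "um = (1/2) *\<^sub>R (ul + ur)" and m: "m = P hm *v um"
    and p: "p = (g / 4) *\<^sub>R (P hl *v hl + P hr *v hr) + P um *v m"
  shows "energy_flux_EC \<rho> \<phi> g Ul bl Ur br =
    (g *\<^sub>R (hr + br) - (1/2) *\<^sub>R (P ur *v ur)) \<bullet> m + ur \<bullet> p
        - g / 2 * (ur \<bullet> (P hm *v (br - bl))) - g / 2 * (ur \<bullet> (P hr *v hr))"
proof -
  \<comment> \<open>Kinetic part: after moving \<open>P(um)\<close> to the other side, the jump
    identity applies to the velocities.\<close>
  have 1: "(P um *v m) \<bullet> (ur - ul) = (1/2) * ((P ur *v ur - P ul *v ul) \<bullet> m)"
    using pc_mat_mult_jump[of \<rho> \<phi> ul ur] assms(7)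
    by (simp add: P_def inner_commute inner_pc_mat_commute)
  \<comment> \<open>Moving \<open>P(hm)\<close> off the mass flux serves both the bottom jump and
    the height jump; for the latter the jump identity then produces the pressures.\<close>
  have 2: "m \<bullet> x = (1/2) * ((ul + ur) \<bullet> (P hm *v x))" for x
    unfolding m assms(7) P_def
    by (simp add: inner_pc_mat_commute pc.scaleR_right)
  have 3: "m \<bullet> (hr - hl) = (1/4) * ((ul + ur) \<bullet> (P hr *v hr - P hl *v hl))"
    using pc_mat_mult_jump[of \<rho> \<phi> hl hr] 2[of "hr - hl"] assms(6)
    by (simp add: P_def)
  have fl: "energy_flux_EC \<rho> \<phi> g Ul bl Ur br = (g *\<^sub>R (hl + bl) - (1/2) *\<^sub>R (P ul *v ul)) \<bullet> m + ul \<bullet> p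
        + g / 2 * (ul \<bullet> (P hm *v (br - bl))) - g / 2 * (ul \<bullet> (P hl *v hl))"
    unfolding energy_flux_EC_def Let_def p m P_def assms(2-7) ..
  have m_jump_b: "g * (m \<bullet> br - m \<bullet> bl) = g / 2 * (ul \<bullet> (P hm *v (br - bl))) + g / 2 * (ur \<bullet> (P hm *v (br - bl)))"
    unfolding inner_diff_right[of m, symmetric] unfolding 2
    by (simp add: inner_add_left distrib_left)
  have m_jump_h: "g * (m \<bullet> hr - m \<bullet> hl) = g / 4 * (ul \<bullet> (P hr *v hr) + ur \<bullet> (P hr *v hr)
       - ul \<bullet> (P hl *v hl) - ur \<bullet> (P hl *v hl))"
    unfolding inner_diff_right[of m, symmetric] 3
    by (simp add: inner_diff_right inner_add_left right_diff_distrib distrib_left)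
  show ?thesis
    unfolding fl p using 1 m_jump_b m_jump_h
    by (simp add: inner_diff_left inner_diff_right inner_add_left inner_add_right inner_commute[of m]
        inner_commute[of "P um *v m"] algebra_simps)
qed

lemma energy_conservative_EC:
  fixes \<rho> :: "real ^ 'd \<Rightarrow> real" and \<phi> :: "'k::finite \<Rightarrow> real ^ 'd \<Rightarrow> real"
  shows "energy_conservative \<rho> \<phi> g (flux_EC \<rho> \<phi> g) (source_EC \<rho> \<phi> g)"
proof -
  let ?H = "energy_flux_EC \<rho> \<phi> g"
  have "((\<lambda>s. energy \<rho> \<phi> g (U s i) (B i)) has_real_derivative
      - (1 / dx) * (?H (U t i) (B i) (U t (i + 1)) (B (i + 1))
                    - ?H (U t (i - 1)) (B (i - 1)) (U t i) (B i))) (at t within T)"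
    if dx: "dx > 0" and sol: "fv_solution \<rho> \<phi> (flux_EC \<rho> \<phi> g) (source_EC \<rho> \<phi> g) dx C T B U"
      and t: "t \<in> T" and i: "i \<in> inner_cells C"
    for dx C T and B :: "int \<Rightarrow> real ^ 'k" and U t i
  proof -
    let ?P = "pc_mat \<rho> \<phi>"
    define h u where "h j = fst (U t j)" and "u j = vel \<rho> \<phi> (U t j)" for j
    define hm um where "hm j = (1/2) *\<^sub>R (h j + h (j + 1))" and "um j = (1/2) *\<^sub>R (u j + u (j + 1))" for j
    define m where "m j = ?P (hm j) *v um j" for j
    define p where "p j = (g / 4) *\<^sub>R (?P (h j) *v h j + ?P (h (j + 1)) *v h (j + 1)) + ?P (um j) *v m j" for j
    define s where "s j = ?P (hm j) *v (B (j + 1) - B j)" for j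
    define D where "D = - (1 / dx) *\<^sub>R (flux_EC \<rho> \<phi> g (U t) i - flux_EC \<rho> \<phi> g (U t) (i - 1))
      + source_EC \<rho> \<phi> g dx B (U t) i"
    have flux: "flux_EC \<rho> \<phi> g (U t) j = (m j, p j)" for j
      by (simp add: flux_EC_def Let_def avg_def m_def p_def hm_def um_def h_def u_def)
    have source: "source_EC \<rho> \<phi> g dx B (U t) i = (0, - (g / (2 * dx)) *\<^sub>R (s i + s (i - 1)))"
      by (simp add: source_EC_def Let_def avg_def jump_def s_def hm_def h_def)
    have h': "fst D = - (1 / dx) *\<^sub>R (m i - m (i - 1))"
      and q': "snd D = - (1 / dx) *\<^sub>R (p i - p (i - 1)) - (g / (2 * dx)) *\<^sub>R (s i + s (i - 1))"
      by (simp_all add: D_def flux source)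
    have Hr: "?H (U t i) (B i) (U t (i + 1)) (B (i + 1)) =
      (g *\<^sub>R (h i + B i) - (1/2) *\<^sub>R (?P (u i) *v u i)) \<bullet> m i + u i \<bullet> p i
        + g / 2 * (u i \<bullet> s i) - g / 2 * (u i \<bullet> (?P (h i) *v h i))"
      by (simp add: energy_flux_EC_def Let_def m_def p_def s_def hm_def um_def h_def u_def)
    \<comment> \<open>The left face is read from its right state, which is cell \<open>i\<close>.
      Both fluxes then carry the entropy variables and the potential of the same cell, and the
      potential cancels in their difference.\<close>
    have Hl: "?H (U t (i - 1)) (B (i - 1)) (U t i) (B i) =
      (g *\<^sub>R (h i + B i) - (1/2) *\<^sub>R (?P (u i) *v u i)) \<bullet> m (i - 1) + u i \<bullet> p (i - 1)
        - g / 2 * (u i \<bullet> s (i - 1)) - g / 2 * (u i \<bullet> (?P (h i) *v h i))"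
      using energy_flux_EC_right[of "h (i - 1)" "U t (i - 1)" "u (i - 1)" \<rho> \<phi> "h i" "U t i" "u i"
          "hm (i - 1)" "um (i - 1)" "m (i - 1)" "p (i - 1)" g "B (i - 1)" "B i"]
      by (simp add: m_def p_def s_def hm_def um_def h_def u_def)
    have iC: "i \<in> C" using i by (simp add: inner_cells_def)
    have U': "((\<lambda>s. U s i) has_vector_derivative D) (at t within T)"
      using sol t i unfolding fv_solution_def D_def by blast
    have pd: "pos_def (?P (fst (U s i)))" if "s \<in> T" for s
      using sol that iC unfolding fv_solution_def by blast
    have fst': "((\<lambda>s. fst (U s i)) has_vector_derivative fst D) (at t within T)"
      by (rule bounded_linear.has_vector_derivative[OF bounded_linear_fst U'])
    have d1: "((\<lambda>s. fst (U s i) \<bullet> fst (U s i)) has_real_derivative 2 * (fst D \<bullet> h i)) (at t within T)"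
      using bounded_bilinear.has_vector_derivative[OF bounded_bilinear_inner fst' fst']
      by (simp add: has_real_derivative_iff_has_vector_derivative h_def inner_commute)
    have d2: "((\<lambda>s. fst (U s i) \<bullet> B i) has_real_derivative fst D \<bullet> B i) (at t within T)"
      using bounded_linear.has_vector_derivative[OF bounded_linear_inner_left fst']
      by (simp add: has_real_derivative_iff_has_vector_derivative)
    have d3: "((\<lambda>s. snd (U s i) \<bullet> vel \<rho> \<phi> (U s i)) has_real_derivative
       2 * (snd D \<bullet> u i) - (?P (fst D) *v u i) \<bullet> u i) (at t within T)"
      unfolding u_def by (rule has_real_derivative_momentum_vel[OF pd t U'])
    have "((\<lambda>s. energy \<rho> \<phi> g (U s i) (B i)) has_real_derivative
        1 / 2 * (2 * (snd D \<bullet> u i) - (?P (fst D) *v u i) \<bullet> u i + g * (2 * (fst D \<bullet> h i)))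
          + g * (fst D \<bullet> B i)) (at t within T)"
      unfolding energy_def power2_norm_eq_inner
      by (intro DERIV_add DERIV_cmult d1 d2 d3)
    \<comment> \<open>Exchanging the arguments exposes the kinetic part \<open>- P(u)u/2\<close> of
      the entropy variable paired with the derivative of \<open>h\<close>.\<close>
    moreover have "(?P (fst D) *v u i) \<bullet> u i = fst D \<bullet> (?P (u i) *v u i)"
      by (subst pc_mat_mult_commute) (rule inner_pc_mat_commute[symmetric])
    moreover have "1 / 2 * (2 * (snd D \<bullet> u i) - fst D \<bullet> (?P (u i) *v u i) + g * (2 * (fst D \<bullet> h i)))
          + g * (fst D \<bullet> B i) = - (1 / dx) * (?H (U t i) (B i) (U t (i + 1)) (B (i + 1))
                    - ?H (U t (i - 1)) (B (i - 1)) (U t i) (B i))"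
      unfolding Hr Hl h' q' using dx
      by (simp add: inner_diff_left inner_add_left inner_diff_right inner_add_right
          inner_commute[of "m _"] inner_commute[of "p _"] inner_commute[of "s _"])
        (simp add: field_simps)
    ultimately show ?thesis by simp
  qed
  then show ?thesis
    unfolding energy_conservative_def by blast
qed

section \<open>Second-order expansions along a filter\<close>

lemma Bfun_add:
  fixes f g :: "'p \<Rightarrow> 'a::real_normed_vector"
  assumes "Bfun f F" "Bfun g F"
  shows "Bfun (\<lambda>p. f p + g p) F"
proof -
  obtain K L where "eventually (\<lambda>p. norm (f p) \<le> K) F" "eventually (\<lambda>p. norm (g p) \<le> L) F"
    using assms by (auto elim!: BfunE)
  then have "eventually (\<lambda>p. norm (f p + g p) \<le> K + L) F"
    by eventually_elim (rule norm_triangle_mono)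
  then show ?thesis by (rule BfunI)
qed

lemma (in bounded_linear) Bfun:
  assumes "Bfun g F"
  shows "Bfun (\<lambda>p. f (g p)) F"
proof -
  obtain K where K: "K \<ge> 0" "\<And>x. norm (f x) \<le> norm x * K"
    using nonneg_bounded by blast
  obtain L where "eventually (\<lambda>p. norm (g p) \<le> L) F"
    using assms by (rule BfunE)
  then have "eventually (\<lambda>p. norm (f (g p)) \<le> L * K) F"
    by eventually_elim (rule order_trans[OF K(2)], rule mult_right_mono, use K in auto)
  then show ?thesis by (rule BfunI)
qed

lemma (in bounded_bilinear) Bfun:
  assumes "Bfun f F" "Bfun g F"
  shows "Bfun (\<lambda>p. prod (f p) (g p)) F"
proof -
  obtain K where K: "K \<ge> 0" "\<And>a b. norm (prod a b) \<le> norm a * norm b * K"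
    using nonneg_bounded by blast
  obtain L M where L: "eventually (\<lambda>p. norm (f p) \<le> L) F" and "L > 0"
    and M: "eventually (\<lambda>p. norm (g p) \<le> M) F"
    using assms by (auto elim!: BfunE)
  from L M have "eventually (\<lambda>p. norm (prod (f p) (g p)) \<le> L * M * K) F"
  proof eventually_elim
    case (elim p)
    then have "norm (f p) * norm (g p) \<le> L * M"
      using \<open>L > 0\<close> by (intro mult_mono) auto
    then show ?case
      using K by (meson mult_right_mono order_trans)
  qed
  then show ?thesis by (rule BfunI)
qed

lemmas Bfun_scaleR = bounded_bilinear.Bfun[OF bounded_bilinear_scaleR]

text \<open>The coefficients depend on \<open>p\<close> because the base point varies along the
  filter. Their eventual boundedness, together with that of the remainder, encodes uniformity in the
  base point.\<close>

definition quad_expansion :: "'p filter \<Rightarrow> ('p \<Rightarrow> real) \<Rightarrow> ('p \<Rightarrow> 'a::real_normed_vector)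
    \<Rightarrow> ('p \<Rightarrow> 'a) \<Rightarrow> ('p \<Rightarrow> 'a) \<Rightarrow> bool" where
  "quad_expansion F \<epsilon> a a0 a1 \<longleftrightarrow> Bfun a0 F \<and> Bfun a1 F \<and>
     (\<exists>r. Bfun r F \<and> eventually (\<lambda>p. a p = a0 p + \<epsilon> p *\<^sub>R a1 p + (\<epsilon> p)\<^sup>2 *\<^sub>R r p) F)"

lemma quad_expansion_linear:
  assumes f: "bounded_linear f" and a: "quad_expansion F \<epsilon> a a0 a1"
  shows "quad_expansion F \<epsilon> (\<lambda>p. f (a p)) (\<lambda>p. f (a0 p)) (\<lambda>p. f (a1 p))"
proof -
  interpret bounded_linear f by (rule f)
  obtain r where "Bfun r F" and r: "eventually (\<lambda>p. a p = a0 p + \<epsilon> p *\<^sub>R a1 p + (\<epsilon> p)\<^sup>2 *\<^sub>R r p) F"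
    using a unfolding quad_expansion_def by blast
  then have "Bfun (\<lambda>p. f (r p)) F" by (intro Bfun)
  moreover have "eventually (\<lambda>p. f (a p) = f (a0 p) + \<epsilon> p *\<^sub>R f (a1 p) + (\<epsilon> p)\<^sup>2 *\<^sub>R f (r p)) F"
    using r by eventually_elim (simp add: add scaleR)
  ultimately show ?thesis
    using a unfolding quad_expansion_def by (blast intro: Bfun)
qed

lemma quad_expansion_add:
  assumes "quad_expansion F \<epsilon> a a0 a1" "quad_expansion F \<epsilon> b b0 b1"
  shows "quad_expansion F \<epsilon> (\<lambda>p. a p + b p) (\<lambda>p. a0 p + b0 p) (\<lambda>p. a1 p + b1 p)"
proof -
  obtain r s where rs: "Bfun r F" "Bfun s F"
    and r: "eventually (\<lambda>p. a p = a0 p + \<epsilon> p *\<^sub>R a1 p + (\<epsilon> p)\<^sup>2 *\<^sub>R r p) F"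
    and s: "eventually (\<lambda>p. b p = b0 p + \<epsilon> p *\<^sub>R b1 p + (\<epsilon> p)\<^sup>2 *\<^sub>R s p) F"
    using assms unfolding quad_expansion_def by blast
  from r s have "eventually (\<lambda>p. a p + b p = (a0 p + b0 p) + \<epsilon> p *\<^sub>R (a1 p + b1 p)
      + (\<epsilon> p)\<^sup>2 *\<^sub>R (r p + s p)) F"
    by eventually_elim (simp add: algebra_simps)
  with rs assms show ?thesis
    unfolding quad_expansion_def by (blast intro: Bfun_add)
qed

lemma quad_expansion_bilinear:
  assumes B: "bounded_bilinear B" and \<epsilon>: "Bfun \<epsilon> F"
    and a: "quad_expansion F \<epsilon> a a0 a1" and b: "quad_expansion F \<epsilon> b b0 b1"
  shows "quad_expansion F \<epsilon> (\<lambda>p. B (a p) (b p)) (\<lambda>p. B (a0 p) (b0 p))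
    (\<lambda>p. B (a0 p) (b1 p) + B (a1 p) (b0 p))"
proof -
  interpret bounded_bilinear B by (rule B)
  obtain r s where rs: "Bfun r F" "Bfun s F"
    and r: "eventually (\<lambda>p. a p = a0 p + \<epsilon> p *\<^sub>R a1 p + (\<epsilon> p)\<^sup>2 *\<^sub>R r p) F"
    and s: "eventually (\<lambda>p. b p = b0 p + \<epsilon> p *\<^sub>R b1 p + (\<epsilon> p)\<^sup>2 *\<^sub>R s p) F"
    using assms unfolding quad_expansion_def by blast
  have 0: "Bfun a0 F" "Bfun a1 F" "Bfun b0 F" "Bfun b1 F"
    using a b unfolding quad_expansion_def by blast+
  \<comment> \<open>\<open>w\<close> collects all terms of order two and higher, divided by
    \<open>\<epsilon>^2\<close>; surplus powers of \<open>\<epsilon>\<close> remain as bounded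
    factors.\<close>
  define w where "w p = (B (a0 p) (s p) + B (a1 p) (b1 p) + B (r p) (b0 p))
    + (\<epsilon> p *\<^sub>R (B (a1 p) (s p) + B (r p) (b1 p)) + \<epsilon> p *\<^sub>R (\<epsilon> p *\<^sub>R B (r p) (s p)))" for p
  have "Bfun w F"
    unfolding w_def by (intro Bfun_add Bfun_scaleR Bfun 0 rs \<epsilon>)
  moreover from r s have "eventually (\<lambda>p. B (a p) (b p) = B (a0 p) (b0 p)
      + \<epsilon> p *\<^sub>R (B (a0 p) (b1 p) + B (a1 p) (b0 p)) + (\<epsilon> p)\<^sup>2 *\<^sub>R w p) F"
    by eventually_elim
      (simp add: w_def add_left add_right scaleR_left scaleR_right algebra_simps power2_eq_square)
  moreover have "Bfun (\<lambda>p. B (a0 p) (b0 p)) F" "Bfun (\<lambda>p. B (a0 p) (b1 p) + B (a1 p) (b0 p)) F"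
    by (intro Bfun_add Bfun 0)+
  ultimately show ?thesis
    unfolding quad_expansion_def by blast
qed

text \<open>A pair is the sum of its embeddings into the two factors, so the linear and additive
  rules apply.\<close>

lemma quad_expansion_Pair:
  assumes "quad_expansion F \<epsilon> a a0 a1" "quad_expansion F \<epsilon> b b0 b1"
  shows "quad_expansion F \<epsilon> (\<lambda>p. (a p, b p)) (\<lambda>p. (a0 p, b0 p)) (\<lambda>p. (a1 p, b1 p))"
proof -
  have "bounded_linear (\<lambda>x::'b. (x, 0::'c))" "bounded_linear (\<lambda>y::'c. (0::'b, y))"
    by (intro bounded_linear_Pair bounded_linear_ident bounded_linear_zero)+
  from quad_expansion_add[OF quad_expansion_linear[OF this(1) assms(1)]
      quad_expansion_linear[OF this(2) assms(2)]]
  show ?thesis by simp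
qed

text \<open>This is the source of second-order accuracy: opposite first-order terms cancel in the
  average.\<close>

lemma quad_expansion_midpoint:
  assumes "quad_expansion F \<epsilon> a a0 a1" "quad_expansion F \<epsilon> b a0 b1" "\<And>p. b1 p = - a1 p"
  shows "quad_expansion F \<epsilon> (\<lambda>p. (1/2) *\<^sub>R (a p + b p)) a0 (\<lambda>_. 0)"
proof -
  have "(\<lambda>p. (1/2) *\<^sub>R (a0 p + a0 p)) = a0" by (simp flip: scaleR_2)
  with quad_expansion_linear[OF bounded_linear_scaleR_right[of "1/2"] quad_expansion_add[OF assms(1,2)]]
  show ?thesis by (simp add: assms(3))
qed

lemma quad_expansion_bilinear_0:
  assumes B: "bounded_bilinear B" and \<epsilon>: "Bfun \<epsilon> F"
    and "quad_expansion F \<epsilon> a a0 (\<lambda>_. 0)" "quad_expansion F \<epsilon> b b0 (\<lambda>_. 0)"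
  shows "quad_expansion F \<epsilon> (\<lambda>p. B (a p) (b p)) (\<lambda>p. B (a0 p) (b0 p)) (\<lambda>_. 0)"
  using quad_expansion_bilinear[OF assms]
  by (simp add: bounded_bilinear.zero_left[OF B] bounded_bilinear.zero_right[OF B])

text \<open>Used to carry coercivity over from the base state to the expanded one.\<close>

lemma quad_expansion_tendsto:
  assumes a: "quad_expansion F \<epsilon> a a0 a1" and \<epsilon>: "(\<epsilon> \<longlongrightarrow> 0) F"
  shows "((\<lambda>p. a p - a0 p) \<longlongrightarrow> 0) F"
proof -
  obtain r where r: "Bfun r F" "eventually (\<lambda>p. a p = a0 p + \<epsilon> p *\<^sub>R a1 p + (\<epsilon> p)\<^sup>2 *\<^sub>R r p) F"
    using a unfolding quad_expansion_def by blast
  have *: "((\<lambda>p. \<epsilon> p *\<^sub>R b p) \<longlongrightarrow> 0) F" if "Bfun b F" for b :: "'a \<Rightarrow> 'b"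
    using bounded_bilinear.Zfun_prod_Bfun[OF bounded_bilinear_scaleR _ that] \<epsilon>
    by (simp add: tendsto_Zfun_iff)
  have "((\<lambda>p. \<epsilon> p *\<^sub>R a1 p + \<epsilon> p *\<^sub>R (\<epsilon> p *\<^sub>R r p)) \<longlongrightarrow> 0 + 0 *\<^sub>R 0) F"
    using a by (intro tendsto_add tendsto_scaleR * r \<epsilon>) (simp add: quad_expansion_def)
  moreover have "eventually (\<lambda>p. \<epsilon> p *\<^sub>R a1 p + \<epsilon> p *\<^sub>R (\<epsilon> p *\<^sub>R r p) = a p - a0 p) F"
    using r(2) by eventually_elim (simp add: power2_eq_square)
  ultimately show ?thesis
    using Lim_transform_eventually by force
qed

lemma quad_expansion_bound:
  assumes "quad_expansion F \<epsilon> a a0 (\<lambda>_. 0)"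
  obtains c where "eventually (\<lambda>p. norm (a p - a0 p) \<le> c * (\<epsilon> p)\<^sup>2) F"
proof -
  obtain r where "Bfun r F" and r: "eventually (\<lambda>p. a p = a0 p + \<epsilon> p *\<^sub>R 0 + (\<epsilon> p)\<^sup>2 *\<^sub>R r p) F"
    using assms unfolding quad_expansion_def by blast
  then obtain c where "eventually (\<lambda>p. norm (r p) \<le> c) F" by (auto elim: BfunE)
  with r have "eventually (\<lambda>p. norm (a p - a0 p) \<le> c * (\<epsilon> p)\<^sup>2) F"
    by eventually_elim (simp add: mult.commute mult_right_mono)
  then show thesis by (rule that)
qed

text \<open>Differentiating \<open>P(h) u = q\<close> gives \<open>P(h) u' = q' - P(h') u\<close>.\<close>

definition vel_deriv ::
  "(real ^ 'd \<Rightarrow> real) \<Rightarrow> ('k::finite \<Rightarrow> real ^ 'd \<Rightarrow> real) \<Rightarrow> 'k sgstate \<Rightarrow> 'k sgstate \<Rightarrow> real ^ 'k"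
  where "vel_deriv \<rho> \<phi> U V =
    matrix_inv (pc_mat \<rho> \<phi> (fst U)) *v (snd V - pc_mat \<rho> \<phi> (fst V) *v vel \<rho> \<phi> U)"

lemma vel_deriv_minus: "vel_deriv \<rho> \<phi> U (- V) = - vel_deriv \<rho> \<phi> U V"
proof -
  have "snd (- V) - pc_mat \<rho> \<phi> (fst (- V)) *v vel \<rho> \<phi> U
    = - (snd V - pc_mat \<rho> \<phi> (fst V) *v vel \<rho> \<phi> U)"
    by (simp add: pc.minus_left)
  then show ?thesis
    unfolding vel_deriv_def by (simp only: linear_neg[OF matrix_vector_mul_linear])
qed

text \<open>A common coercivity constant bounds all the inverses by
  \<open>1 / \<alpha>\<close>.\<close>

lemma Bfun_matrix_inv:
  assumes A: "eventually (\<lambda>p. coercive \<alpha> (A p)) F" and q: "Bfun q F"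
  shows "Bfun (\<lambda>p. matrix_inv (A p) *v q p) F"
proof -
  obtain K where "eventually (\<lambda>p. norm (q p) \<le> K) F"
    using q by (auto elim: BfunE)
  with A have "eventually (\<lambda>p. norm (matrix_inv (A p) *v q p) \<le> K / \<alpha>) F"
  proof eventually_elim
    case (elim p)
    have "norm (matrix_inv (A p) *v q p) \<le> norm (q p) / \<alpha>"
      using coercive_norm_le[OF elim(1), of "matrix_inv (A p) *v q p"]
      by (simp add: coercive_mult_matrix_inv[OF elim(1)])
    also have "\<dots> \<le> K / \<alpha>"
      using elim by (intro divide_right_mono) (auto simp: coercive_def)
    finally show ?case .
  qed
  then show ?thesis by (rule BfunI)
qed

text \<open>Inserting \<open>u0 + \<epsilon> u1\<close> into \<open>P(h) u = q\<close> leaves a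
  residual of order \<open>\<epsilon>^2\<close>. The inverses of \<open>P(h)\<close> are uniformly
  bounded, so the error in the velocity has the same order.\<close>

lemma quad_expansion_vel:
  fixes U U0 U1 :: "'p \<Rightarrow> 'k::finite sgstate"
  assumes U: "quad_expansion F \<epsilon> U U0 U1" and \<epsilon>: "Bfun \<epsilon> F" "(\<epsilon> \<longlongrightarrow> 0) F"
    and co: "eventually (\<lambda>p. coercive \<alpha> (pc_mat \<rho> \<phi> (fst (U0 p)))) F"
  shows "quad_expansion F \<epsilon> (\<lambda>p. vel \<rho> \<phi> (U p)) (\<lambda>p. vel \<rho> \<phi> (U0 p))
    (\<lambda>p. vel_deriv \<rho> \<phi> (U0 p) (U1 p))"
proof -
  let ?P = "pc_mat \<rho> \<phi>" and ?u0 = "\<lambda>p. vel \<rho> \<phi> (U0 p)" and ?u1 = "\<lambda>p. vel_deriv \<rho> \<phi> (U0 p) (U1 p)"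
  obtain r where "Bfun r F" and r: "eventually (\<lambda>p. U p = U0 p + \<epsilon> p *\<^sub>R U1 p + (\<epsilon> p)\<^sup>2 *\<^sub>R r p) F"
    using U unfolding quad_expansion_def by blast
  have Bfst: "Bfun (\<lambda>p. fst (V p)) F" and Bsnd: "Bfun (\<lambda>p. snd (V p)) F"
    if "Bfun V F" for V :: "'p \<Rightarrow> 'k sgstate"
    by (rule bounded_linear.Bfun[OF bounded_linear_fst that],
        rule bounded_linear.Bfun[OF bounded_linear_snd that])
  have BU: "Bfun U0 F" "Bfun U1 F"
    using U unfolding quad_expansion_def by blast+
  have Bminus: "Bfun (\<lambda>p. a p - b p) F" if "Bfun a F" "Bfun b F" for a b :: "'p \<Rightarrow> real ^ 'k"
    using Bfun_add[OF that(1) bounded_linear.Bfun[OF bounded_linear_minus[OF bounded_linear_ident] that(2)]]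
    by simp
  have u0: "Bfun ?u0 F"
    unfolding vel_def by (intro Bfun_matrix_inv[OF co] Bsnd BU)
  have u1: "Bfun ?u1 F"
    unfolding vel_deriv_def by (intro Bfun_matrix_inv[OF co] Bminus pc.Bfun Bsnd Bfst BU u0)
  have co': "eventually (\<lambda>p. coercive (\<alpha> / 2) (?P (fst (U p)))) F"
    using bounded_linear.tendsto[OF bounded_linear_fst quad_expansion_tendsto[OF U \<epsilon>(2)]]
    by (intro eventually_coercive_pc_mat[OF co]) simp
  \<comment> \<open>\<open>Z\<close> is that residual divided by \<open>\<epsilon>^2\<close>; orders
    zero and one cancel by the equations that determine \<open>u0\<close> and
    \<open>u1\<close>.\<close>
  define Z where "Z p = (snd (r p) - ?P (fst (U1 p)) *v ?u1 p)
    - (?P (fst (r p)) *v ?u0 p + \<epsilon> p *\<^sub>R (?P (fst (r p)) *v ?u1 p))" for p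
  have "Bfun Z F"
    unfolding Z_def by (intro Bminus Bfun_add Bfun_scaleR pc.Bfun Bsnd Bfst BU u0 u1 \<epsilon> \<open>Bfun r F\<close>)
  then have "Bfun (\<lambda>p. matrix_inv (?P (fst (U p))) *v Z p) F"
    by (rule Bfun_matrix_inv[OF co'])
  moreover from r co co' have "eventually (\<lambda>p. vel \<rho> \<phi> (U p) = ?u0 p + \<epsilon> p *\<^sub>R ?u1 p
      + (\<epsilon> p)\<^sup>2 *\<^sub>R (matrix_inv (?P (fst (U p))) *v Z p)) F"
  proof eventually_elim
    case (elim p)
    let ?A = "?P (fst (U p))"
    have a: "?A *v vel \<rho> \<phi> (U p) = snd (U p)" "?P (fst (U0 p)) *v ?u0 p = snd (U0 p)"
      "?P (fst (U0 p)) *v ?u1 p = snd (U1 p) - ?P (fst (U1 p)) *v ?u0 p"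
      unfolding vel_def vel_deriv_def
      by (rule coercive_mult_matrix_inv[OF elim(3)] coercive_mult_matrix_inv[OF elim(2)])+
    have "?A *v (vel \<rho> \<phi> (U p) - ?u0 p - \<epsilon> p *\<^sub>R ?u1 p)
        = snd (U p) - ?A *v ?u0 p - \<epsilon> p *\<^sub>R (?A *v ?u1 p)"
      by (simp add: pc.diff_right pc.scaleR_right a)
    also have "\<dots> = (\<epsilon> p)\<^sup>2 *\<^sub>R Z p"
      unfolding elim(1) Z_def
      by (simp add: pc.add_left pc.scaleR_left a(2,3) algebra_simps power2_eq_square)
    finally have "matrix_inv ?A *v (?A *v (vel \<rho> \<phi> (U p) - ?u0 p - \<epsilon> p *\<^sub>R ?u1 p))
        = (\<epsilon> p)\<^sup>2 *\<^sub>R (matrix_inv ?A *v Z p)"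
      by (simp add: matrix_vector_mult_scaleR)
    then show ?case
      by (simp add: coercive_mult_matrix_inv(2)[OF elim(3)] algebra_simps)
  qed
  ultimately show ?thesis
    unfolding quad_expansion_def using u0 u1 by blast
qed

section \<open>Cell averages of smooth functions\<close>

text \<open>Pairs of a base point and a mesh width. The principal factor forces one threshold on the
  width to serve every point of \<open>Y\<close>.\<close>

abbreviation mesh_filter :: "real set \<Rightarrow> (real \<times> real) filter" where
  "mesh_filter Y \<equiv> principal Y \<times>\<^sub>F at_right 0"

lemma eventually_mesh_filter:
  "eventually P (mesh_filter Y) \<longleftrightarrow> (\<exists>\<delta>>0. \<forall>y\<in>Y. \<forall>\<epsilon>. 0 < \<epsilon> \<and> \<epsilon> < \<delta> \<longrightarrow> P (y, \<epsilon>))"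
proof
  assume "eventually P (mesh_filter Y)"
  then obtain Q R where "\<forall>y\<in>Y. Q y" "eventually R (at_right 0)" "\<And>y \<epsilon>. Q y \<Longrightarrow> R \<epsilon> \<Longrightarrow> P (y, \<epsilon>)"
    unfolding eventually_prod_filter eventually_principal by blast
  then show "\<exists>\<delta>>0. \<forall>y\<in>Y. \<forall>\<epsilon>. 0 < \<epsilon> \<and> \<epsilon> < \<delta> \<longrightarrow> P (y, \<epsilon>)"
    unfolding eventually_at_right_field by (metis (full_types))
next
  assume "\<exists>\<delta>>0. \<forall>y\<in>Y. \<forall>\<epsilon>. 0 < \<epsilon> \<and> \<epsilon> < \<delta> \<longrightarrow> P (y, \<epsilon>)"
  then obtain \<delta> where \<delta>: "\<delta> > 0" "\<forall>y\<in>Y. \<forall>\<epsilon>. 0 < \<epsilon> \<and> \<epsilon> < \<delta> \<longrightarrow> P (y, \<epsilon>)"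
    by blast
  then have "eventually (\<lambda>\<epsilon>. 0 < \<epsilon> \<and> \<epsilon> < \<delta>) (at_right (0::real))"
    unfolding eventually_at_right_field by blast
  with \<delta>(2) show "eventually P (mesh_filter Y)"
    unfolding eventually_prod_filter eventually_principal
    by (intro exI[of _ "\<lambda>y. y \<in> Y"] exI[of _ "\<lambda>\<epsilon>. 0 < \<epsilon> \<and> \<epsilon> < \<delta>"]) auto
qed

lemma tendsto_snd_mesh_filter: "(snd \<longlongrightarrow> 0) (mesh_filter Y)"
  by (rule tendstoI) (auto simp: eventually_mesh_filter dist_real_def)

lemma Bfun_snd_mesh_filter: "Bfun snd (mesh_filter Y)"
  by (rule BfunI[of _ 1]) (auto simp: eventually_mesh_filter intro!: exI[of _ 1])

text \<open>One step of a Taylor remainder estimate: the mean value inequality turns a bound on the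
  derivative into a bound on the function with one more power of the distance to
  \<open>c\<close>.\<close>

lemma norm_le_power_Suc:
  fixes R R' :: "real \<Rightarrow> 'a::real_normed_vector"
  assumes "convex S" "c \<in> S" "x \<in> S" "R c = 0" "M \<ge> 0"
    and der: "\<And>x. x \<in> S \<Longrightarrow> (R has_vector_derivative R' x) (at x)"
    and le: "\<And>x. x \<in> S \<Longrightarrow> norm (R' x) \<le> M * \<bar>x - c\<bar> ^ n"
  shows "norm (R x) \<le> M * \<bar>x - c\<bar> ^ Suc n"
proof -
  \<comment> \<open>On the segment no point is farther from \<open>c\<close> than \<open>x\<close>,
    so the derivative bound at distance \<open>\<bar>x - c\<bar>\<close> holds throughout.\<close>
  let ?T = "closed_segment c x"
  have T: "?T \<subseteq> S" using assms(1-3) by (simp add: closed_segment_subset)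
  have "norm (R x - R c) \<le> (M * \<bar>x - c\<bar> ^ n) * norm (x - c)"
  proof (rule differentiable_bound[of ?T R "\<lambda>y h. h *\<^sub>R R' y"])
    fix y assume y: "y \<in> ?T"
    show "(R has_derivative (\<lambda>h. h *\<^sub>R R' y)) (at y within ?T)"
      using der y T has_vector_derivative_at_within unfolding has_vector_derivative_def
      by (metis has_derivative_at_withinI subsetD)
    have "\<bar>y - c\<bar> \<le> \<bar>x - c\<bar>"
      using y by (auto simp: closed_segment_eq_real_ivl split: if_splits)
    then have "norm (R' y) \<le> M * \<bar>x - c\<bar> ^ n"
      using le[of y] y T \<open>M \<ge> 0\<close> by (meson abs_ge_zero mult_left_mono order_trans power_mono subsetD)
    then have "norm (h *\<^sub>R R' y) \<le> (M * \<bar>x - c\<bar> ^ n) * norm h" for h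
      by (simp add: mult.commute[of _ "\<bar>h\<bar>"] mult_left_mono)
    then show "onorm (\<lambda>h. h *\<^sub>R R' y) \<le> M * \<bar>x - c\<bar> ^ n"
      by (rule onorm_le)
  qed auto
  then show ?thesis
    using \<open>R c = 0\<close> by (simp add: mult_ac)
qed

text \<open>For \<open>p = (y, \<epsilon>)\<close> this averages over the cell of length \<open>\<epsilon>\<close> whose left end is \<open>y + a\<epsilon>\<close>: faces
  need \<open>a \<in> {-1, 0}\<close> (\<open>y\<close> an interface), sources \<open>a \<in> {-3/2, -1/2, 1/2}\<close> (\<open>y\<close> a cell center).\<close>

definition shifted_average :: "(real \<Rightarrow> 'a::euclidean_space) \<Rightarrow> real \<Rightarrow> real \<times> real \<Rightarrow> 'a" where
  "shifted_average f a p =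
     (1 / snd p) *\<^sub>R integral {fst p + a * snd p..fst p + (a + 1) * snd p} f"

text \<open>The coefficients are the integrals of \<open>s\<close> and of \<open>s^2 / 2\<close>
  over the interval from \<open>a\<close> to \<open>a + 1\<close>. The quadratic term is kept
  explicit because differences of averages are later divided by the mesh width.\<close>

lemma shifted_average_expansion:
  fixes f :: "real \<Rightarrow> 'a::euclidean_space"
  assumes X: "open X" and f: "smooth_on X f" and Y: "compact Y" "Y \<subseteq> X" and a: "-2 \<le> a" "a \<le> 1"
  defines "f1 \<equiv> \<lambda>x. vector_derivative f (at x)"
  defines "f2 \<equiv> \<lambda>x. vector_derivative f1 (at x)"
  obtains r where "Bfun r (mesh_filter Y)"
    "eventually (\<lambda>p. shifted_average f a p = f (fst p) + (snd p * (a + 1/2)) *\<^sub>R f1 (fst p)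
       + ((snd p)\<^sup>2 * (a\<^sup>2 + a + 1/3) / 2) *\<^sub>R f2 (fst p) + (snd p) ^ 3 *\<^sub>R r p) (mesh_filter Y)"
proof -
  define f3 where "f3 x = vector_derivative f2 (at x)" for x
  let ?D = "\<lambda>n. ((\<lambda>f' x. vector_derivative f' (at x)) ^^ n) f"
  have D: "?D n differentiable_on X" for n
    using f unfolding smooth_on_def by blast
  have der: "(?D n has_vector_derivative ?D (Suc n) x) (at x)" if "x \<in> X" for n x
  proof -
    have "?D n differentiable (at x)"
      using D[of n] that X by (simp add: differentiable_on_eq_differentiable_at)
    then show ?thesis by (simp add: vector_derivative_works)
  qed
  have D_eq: "?D 0 = f" "?D 1 = f1" "?D 2 = f2" "?D 3 = f3"
    by (simp_all add: numeral_2_eq_2 numeral_3_eq_3 f1_def f2_def f3_def fun_eq_iff)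
  have f': "(f has_vector_derivative f1 x) (at x)" if "x \<in> X" for x
    using der[OF that, of 0] by (simp add: f1_def)
  have f1': "(f1 has_vector_derivative f2 x) (at x)" if "x \<in> X" for x
    using der[OF that, of 1] unfolding D_eq by (simp add: numeral_2_eq_2[symmetric] D_eq)
  have f2': "(f2 has_vector_derivative f3 x) (at x)" if "x \<in> X" for x
    using der[OF that, of 2] unfolding D_eq by (simp add: numeral_3_eq_3[symmetric] D_eq)
  have "continuous_on X f3"
    using D[of 3] unfolding D_eq by (rule differentiable_imp_continuous_on)
  \<comment> \<open>A closed neighborhood of \<open>Y\<close> inside \<open>X\<close>; being the sum
    of \<open>Y\<close> and a closed ball it is compact, so the third derivative is bounded on
    it.\<close>
  obtain e where e: "e > 0" "(\<Union>y\<in>Y. cball y e) \<subseteq> X"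
    using compact_subset_open_imp_cball_epsilon_subset[OF Y(1) X Y(2)] by blast
  have "(\<Union>y\<in>Y. cball y e) = {y + z |y z. y \<in> Y \<and> z \<in> cball 0 e}"
  proof (intro set_eqI iffI)
    fix x assume "x \<in> (\<Union>y\<in>Y. cball y e)"
    then obtain y where "y \<in> Y" "x - y \<in> cball 0 e"
      by (auto simp: dist_norm norm_minus_commute)
    then show "x \<in> {y + z |y z. y \<in> Y \<and> z \<in> cball 0 e}"
      by (intro CollectI exI[of _ y] exI[of _ "x - y"]) simp
  qed (force simp: dist_norm)
  then have "compact (\<Union>y\<in>Y. cball y e)"
    using compact_sums[OF Y(1) compact_cball[of 0 e]] by simp
  then have "bounded (f3 ` (\<Union>y\<in>Y. cball y e))"
    using \<open>continuous_on X f3\<close> e(2)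
    by (meson compact_continuous_image compact_imp_bounded continuous_on_subset)
  then obtain M where M: "M > 0" "\<And>x. x \<in> (\<Union>y\<in>Y. cball y e) \<Longrightarrow> norm (f3 x) \<le> M"
    unfolding bounded_pos by blast
  define A where "A p = f (fst p) + (snd p * (a + 1/2)) *\<^sub>R f1 (fst p)
       + ((snd p)\<^sup>2 * (a\<^sup>2 + a + 1/3) / 2) *\<^sub>R f2 (fst p)" for p
  \<comment> \<open>Defined as a quotient, \<open>r\<close> makes the expansion an identity for
    positive widths; only its boundedness needs an argument.\<close>
  define r where "r p = (1 / (snd p) ^ 3) *\<^sub>R (shifted_average f a p - A p)" for p
  have bound: "norm (shifted_average f a (y, \<epsilon>) - A (y, \<epsilon>)) \<le> 8 * M * \<epsilon> ^ 3"
    if y: "y \<in> Y" and \<epsilon>: "0 < \<epsilon>" "\<epsilon> < e / 2" for y \<epsilon>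
  proof -
    \<comment> \<open>The range of \<open>a\<close> puts the cell within distance
      \<open>2 * \<epsilon>\<close> of \<open>y\<close>, and \<open>\<epsilon> < e / 2\<close> keeps
      this inside the neighborhood. The factor 8 is the cube of that 2.\<close>
    define S where "S = {y - 2 * \<epsilon>..y + 2 * \<epsilon>}"
    have S: "convex S" "y \<in> S" and SY: "S \<subseteq> (\<Union>y\<in>Y. cball y e)"
      using y \<epsilon> by (auto simp: S_def dist_real_def intro!: bexI[of _ y])
    with e(2) have SX: "S \<subseteq> X" by blast
    \<comment> \<open>Taylor remainders of \<open>f2\<close>, \<open>f1\<close> and \<open>f\<close>
      at \<open>y\<close>: the derivative of \<open>R\<close> is \<open>R1\<close>, that of
      \<open>R1\<close> is \<open>R2\<close>, and that of \<open>R2\<close> is \<open>f3\<close>.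
      Each integration gains one power of the distance.\<close>
    define R2 where "R2 x = f2 x - f2 y" for x
    define R1 where "R1 x = f1 x - f1 y - (x - y) *\<^sub>R f2 y" for x
    define R where "R x = f x - f y - (x - y) *\<^sub>R f1 y - ((x - y)\<^sup>2 / 2) *\<^sub>R f2 y" for x
    have "norm (f3 x) \<le> M * \<bar>x - y\<bar> ^ 0" if "x \<in> S" for x
      using M(2)[OF subsetD[OF SY that]] by simp
    moreover have "(R2 has_vector_derivative f3 x) (at x)" if "x \<in> S" for x
      unfolding R2_def using that SX
      by (auto intro!: derivative_eq_intros f2')
    ultimately have R2: "norm (R2 x) \<le> M * \<bar>x - y\<bar> ^ Suc 0" if "x \<in> S" for x
      using that S M(1) by (intro norm_le_power_Suc[of S y x R2 M f3]) (auto simp: R2_def)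
    moreover have "(R1 has_vector_derivative R2 x) (at x)" if "x \<in> S" for x
      unfolding R1_def R2_def using that SX
      by (auto intro!: derivative_eq_intros f1')
    ultimately have R1: "norm (R1 x) \<le> M * \<bar>x - y\<bar> ^ Suc (Suc 0)" if "x \<in> S" for x
      using that S M(1) by (intro norm_le_power_Suc[of S y x R1 M R2]) (auto simp: R1_def)
    moreover have R': "(R has_vector_derivative R1 x) (at x)" if "x \<in> S" for x
      unfolding R1_def R_def using that SX
      by (auto intro!: derivative_eq_intros f')
    ultimately have R: "norm (R x) \<le> M * \<bar>x - y\<bar> ^ Suc (Suc (Suc 0))" if "x \<in> S" for x
      using that S M(1) by (intro norm_le_power_Suc[of S y x R M R1]) (auto simp: R_def)
    let ?l = "y + a * \<epsilon>" and ?u = "y + (a + 1) * \<epsilon>"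
    have "-2 * \<epsilon> \<le> a * \<epsilon>" "(a + 1) * \<epsilon> \<le> 2 * \<epsilon>"
      using a \<epsilon> by (intro mult_right_mono; simp)+
    then have T: "{?l..?u} \<subseteq> S" by (auto simp: S_def)
    have lu: "?u - ?l = \<epsilon>" "?l \<le> ?u" using \<epsilon> by (auto simp: algebra_simps)
    have "continuous_on {?l..?u} f"
      using f' T SX by (meson continuous_at_imp_continuous_on has_vector_derivative_continuous subsetD)
    then have int: "(f has_integral integral {?l..?u} f) {?l..?u}"
      using integrable_continuous_real integrable_integral by blast
    \<comment> \<open>An antiderivative of the quadratic Taylor polynomial; its increment over the
      cell, divided by the width, is \<open>A\<close>.\<close>
    define G where "G x = (x - y) *\<^sub>R f y + ((x - y)\<^sup>2 / 2) *\<^sub>R f1 y + ((x - y) ^ 3 / 6) *\<^sub>R f2 y" for x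
    have "((\<lambda>x. f y + (x - y) *\<^sub>R f1 y + ((x - y)\<^sup>2 / 2) *\<^sub>R f2 y) has_integral G ?u - G ?l) {?l..?u}"
    proof (rule fundamental_theorem_of_calculus[OF lu(2)])
      fix x
      show "(G has_vector_derivative f y + (x - y) *\<^sub>R f1 y + ((x - y)\<^sup>2 / 2) *\<^sub>R f2 y)
          (at x within {?l..?u})"
        unfolding G_def by (auto intro!: derivative_eq_intros)
    qed
    from has_integral_diff[OF int this]
    have "(R has_integral integral {?l..?u} f - (G ?u - G ?l)) (cbox ?l ?u)"
      by (simp add: R_def[abs_def] algebra_simps)
    moreover have "norm (R x) \<le> 8 * M * \<epsilon> ^ 3" if "x \<in> cbox ?l ?u" for x
    proof -
      have x: "x \<in> S" using that T by auto
      then have "\<bar>x - y\<bar> ^ 3 \<le> (2 * \<epsilon>) ^ 3"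
        by (intro power_mono) (auto simp: S_def)
      then have "M * \<bar>x - y\<bar> ^ 3 \<le> M * (2 * \<epsilon>) ^ 3"
        using M(1) by simp
      with R[OF x] show ?thesis
        by (simp add: numeral_3_eq_3 power_mult_distrib mult_ac)
    qed
    ultimately have "norm (integral {?l..?u} f - (G ?u - G ?l)) \<le> 8 * M * \<epsilon> ^ 3 * measure lborel (cbox ?l ?u)"
      using M(1) \<epsilon> by (intro has_integral_bound[where f = R]) auto
    also have "measure lborel (cbox ?l ?u) = \<epsilon>" using lu by simp
    finally have "norm ((1 / \<epsilon>) *\<^sub>R (integral {?l..?u} f - (G ?u - G ?l))) \<le> 8 * M * \<epsilon> ^ 3"
      using \<epsilon> by (simp add: divide_le_eq)
    moreover have "(1 / \<epsilon>) *\<^sub>R (G ?u - G ?l) = A (y, \<epsilon>)"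
    proof -
      have "G ?u - G ?l = ((a + 1) * \<epsilon> - a * \<epsilon>) *\<^sub>R f y + ((((a + 1) * \<epsilon>)\<^sup>2 - (a * \<epsilon>)\<^sup>2) / 2) *\<^sub>R f1 y
          + ((((a + 1) * \<epsilon>) ^ 3 - (a * \<epsilon>) ^ 3) / 6) *\<^sub>R f2 y"
        by (simp add: G_def diff_divide_distrib scaleR_diff_left)
      also have "(a + 1) * \<epsilon> - a * \<epsilon> = \<epsilon>" by (simp add: algebra_simps)
      also have "(((a + 1) * \<epsilon>)\<^sup>2 - (a * \<epsilon>)\<^sup>2) / 2 = \<epsilon> * (\<epsilon> * (a + 1/2))"
        by (simp add: power2_eq_square field_simps)
      also have "(((a + 1) * \<epsilon>) ^ 3 - (a * \<epsilon>) ^ 3) / 6 = \<epsilon> * (\<epsilon>\<^sup>2 * (a\<^sup>2 + a + 1/3) / 2)"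
        by (simp add: power2_eq_square power3_eq_cube field_simps)
      finally show ?thesis
        using \<epsilon> by (simp add: A_def scaleR_add_right)
    qed
    ultimately show ?thesis
      by (simp add: shifted_average_def scaleR_diff_right)
  qed
  show thesis
  proof
    have "eventually (\<lambda>p. norm (r p) \<le> 8 * M) (mesh_filter Y)"
      unfolding eventually_mesh_filter using bound e(1)
      by (intro exI[of _ "e / 2"]) (auto simp: r_def divide_le_eq)
    then show "Bfun r (mesh_filter Y)" by (rule BfunI)
    show "eventually (\<lambda>p. shifted_average f a p = f (fst p) + (snd p * (a + 1/2)) *\<^sub>R f1 (fst p)
       + ((snd p)\<^sup>2 * (a\<^sup>2 + a + 1/3) / 2) *\<^sub>R f2 (fst p) + (snd p) ^ 3 *\<^sub>R r p) (mesh_filter Y)"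
      unfolding eventually_mesh_filter
      by (intro exI[of _ 1]) (auto simp: r_def A_def)
  qed
qed

section \<open>Expansions of cell averages and their difference quotients\<close>

lemma smooth_on_vector_derivative:
  assumes "smooth_on X f"
  shows "smooth_on X (\<lambda>x. vector_derivative f (at x))"
  unfolding smooth_on_def
proof
  fix n
  have "((\<lambda>f' x. vector_derivative f' (at x)) ^^ Suc n) f differentiable_on X"
    using assms unfolding smooth_on_def by blast
  then show "((\<lambda>f' x. vector_derivative f' (at x)) ^^ n) (\<lambda>x. vector_derivative f (at x)) differentiable_on X"
    by (simp only: funpow_Suc_right comp_apply)
qed

lemma smooth_on_continuous_on:
  assumes "smooth_on X f"
  shows "continuous_on X f"
  using assms[unfolded smooth_on_def, rule_format, of 0]
  by (simp add: differentiable_imp_continuous_on)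

lemma Bfun_fst_mesh_filter:
  fixes f :: "real \<Rightarrow> 'a::real_normed_vector"
  assumes "continuous_on X f" "compact Y" "Y \<subseteq> X"
  shows "Bfun (\<lambda>p. f (fst p)) (mesh_filter Y)"
proof -
  have "bounded (f ` Y)"
    using assms by (meson compact_continuous_image compact_imp_bounded continuous_on_subset)
  then obtain K where "\<forall>y\<in>Y. norm (f y) \<le> K"
    unfolding bounded_iff by blast
  then have "eventually (\<lambda>p. norm (f (fst p)) \<le> K) (mesh_filter Y)"
    unfolding eventually_mesh_filter by (intro exI[of _ 1]) auto
  then show ?thesis by (rule BfunI)
qed

text \<open>The quadratic and cubic terms are absorbed into the remainder.\<close>

lemma quad_expansion_shifted_average:
  fixes f :: "real \<Rightarrow> 'a::euclidean_space"
  assumes X: "open X" and f: "smooth_on X f" and Y: "compact Y" "Y \<subseteq> X" and a: "-2 \<le> a" "a \<le> 1"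
  shows "quad_expansion (mesh_filter Y) snd (shifted_average f a) (\<lambda>p. f (fst p))
    (\<lambda>p. (a + 1/2) *\<^sub>R vector_derivative f (at (fst p)))"
proof -
  define f1 where "f1 x = vector_derivative f (at x)" for x
  define f2 where "f2 x = vector_derivative f1 (at x)" for x
  have f1: "smooth_on X f1"
    unfolding f1_def by (rule smooth_on_vector_derivative[OF f])
  have f2: "smooth_on X f2"
    unfolding f2_def by (rule smooth_on_vector_derivative[OF f1])
  note B = smooth_on_continuous_on[THEN Bfun_fst_mesh_filter, OF _ Y]
  obtain r where "Bfun r (mesh_filter Y)" and
    r: "eventually (\<lambda>p. shifted_average f a p = f (fst p) + (snd p * (a + 1/2)) *\<^sub>R f1 (fst p)
       + ((snd p)\<^sup>2 * (a\<^sup>2 + a + 1/3) / 2) *\<^sub>R f2 (fst p) + (snd p) ^ 3 *\<^sub>R r p) (mesh_filter Y)"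
    using shifted_average_expansion[OF X f Y a] unfolding f1_def f2_def by blast
  define w where "w p = ((a\<^sup>2 + a + 1/3) / 2) *\<^sub>R f2 (fst p) + snd p *\<^sub>R r p" for p
  have "Bfun w (mesh_filter Y)"
    unfolding w_def by (intro Bfun_add Bfun_scaleR Bfun_const B f2 Bfun_snd_mesh_filter \<open>Bfun r _\<close>)
  moreover have "eventually (\<lambda>p. shifted_average f a p = f (fst p) + snd p *\<^sub>R ((a + 1/2) *\<^sub>R f1 (fst p))
      + (snd p)\<^sup>2 *\<^sub>R w p) (mesh_filter Y)"
    using r by eventually_elim
      (simp add: w_def scaleR_add_right power2_eq_square power3_eq_cube mult.assoc)
  moreover have "Bfun (\<lambda>p. (a + 1/2) *\<^sub>R f1 (fst p)) (mesh_filter Y)"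
    by (intro Bfun_scaleR Bfun_const B f1)
  ultimately show ?thesis
    unfolding quad_expansion_def f1_def using B[OF f] by blast
qed

text \<open>The values of \<open>f\<close> cancel between adjacent cells, and division by the width
  lowers each order by one; the quadratic coefficients of the averages differ by exactly
  \<open>a + 1\<close>.\<close>

lemma quad_expansion_shifted_average_jump:
  fixes f :: "real \<Rightarrow> 'a::euclidean_space"
  assumes X: "open X" and f: "smooth_on X f" and Y: "compact Y" "Y \<subseteq> X" and a: "-2 \<le> a" "a \<le> 0"
  defines "f1 \<equiv> \<lambda>x. vector_derivative f (at x)"
  shows "quad_expansion (mesh_filter Y) snd
    (\<lambda>p. (1 / snd p) *\<^sub>R (shifted_average f (a + 1) p - shifted_average f a p)) (\<lambda>p. f1 (fst p))
    (\<lambda>p. (a + 1) *\<^sub>R vector_derivative f1 (at (fst p)))"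
proof -
  define f2 where "f2 x = vector_derivative f1 (at x)" for x
  have f1: "smooth_on X f1"
    unfolding f1_def by (rule smooth_on_vector_derivative[OF f])
  have f2: "smooth_on X f2"
    unfolding f2_def by (rule smooth_on_vector_derivative[OF f1])
  note B = smooth_on_continuous_on[THEN Bfun_fst_mesh_filter, OF _ Y]
  obtain r where "Bfun r (mesh_filter Y)" and
    r: "eventually (\<lambda>p. shifted_average f a p = f (fst p) + (snd p * (a + 1/2)) *\<^sub>R f1 (fst p)
       + ((snd p)\<^sup>2 * (a\<^sup>2 + a + 1/3) / 2) *\<^sub>R f2 (fst p) + (snd p) ^ 3 *\<^sub>R r p) (mesh_filter Y)"
    using shifted_average_expansion[OF X f Y, of a] a unfolding f1_def f2_def by auto
  obtain s where "Bfun s (mesh_filter Y)" and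
    s: "eventually (\<lambda>p. shifted_average f (a + 1) p = f (fst p) + (snd p * (a + 1 + 1/2)) *\<^sub>R f1 (fst p)
       + ((snd p)\<^sup>2 * ((a + 1)\<^sup>2 + (a + 1) + 1/3) / 2) *\<^sub>R f2 (fst p) + (snd p) ^ 3 *\<^sub>R s p) (mesh_filter Y)"
    using shifted_average_expansion[OF X f Y, of "a + 1"] a unfolding f1_def f2_def by auto
  have "Bfun (\<lambda>p. s p + (-1) *\<^sub>R r p) (mesh_filter Y)"
    by (intro Bfun_add Bfun_scaleR Bfun_const \<open>Bfun r _\<close> \<open>Bfun s _\<close>)
  moreover have "eventually (\<lambda>p. snd p > 0) (mesh_filter Y)"
    unfolding eventually_mesh_filter by (intro exI[of _ 1]) auto
  with r s have "eventually (\<lambda>p. (1 / snd p) *\<^sub>R (shifted_average f (a + 1) p - shifted_average f a p)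
      = f1 (fst p) + snd p *\<^sub>R ((a + 1) *\<^sub>R f2 (fst p)) + (snd p)\<^sup>2 *\<^sub>R (s p + (-1) *\<^sub>R r p)) (mesh_filter Y)"
  proof eventually_elim
    case (elim p)
    have "shifted_average f (a + 1) p - shifted_average f a p
       = (snd p * (a + 1 + 1/2) - snd p * (a + 1/2)) *\<^sub>R f1 (fst p)
       + ((snd p)\<^sup>2 * ((a + 1)\<^sup>2 + (a + 1) + 1/3) / 2 - (snd p)\<^sup>2 * (a\<^sup>2 + a + 1/3) / 2) *\<^sub>R f2 (fst p)
       + (snd p) ^ 3 *\<^sub>R (s p - r p)"
      unfolding elim(1,2) by (simp only: scaleR_diff_left scaleR_diff_right) simp
    also have "snd p * (a + 1 + 1/2) - snd p * (a + 1/2) = snd p"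
      by (simp add: algebra_simps)
    also have "(snd p)\<^sup>2 * ((a + 1)\<^sup>2 + (a + 1) + 1/3) / 2 - (snd p)\<^sup>2 * (a\<^sup>2 + a + 1/3) / 2
       = snd p * (snd p * (a + 1))"
      by (simp add: power2_eq_square field_simps)
    finally show ?case
      using elim(3) by (simp add: scaleR_add_right power2_eq_square power3_eq_cube)
  qed
  moreover have "Bfun (\<lambda>p. (a + 1) *\<^sub>R f2 (fst p)) (mesh_filter Y)"
    by (intro Bfun_scaleR Bfun_const B f2)
  ultimately show ?thesis
    unfolding quad_expansion_def f2_def using B[OF f1] by blast
qed

section \<open>Truncation errors\<close>

text \<open>Seen from the interface, the adjacent cells have offsets -1 and 0, hence opposite
  first-order coefficients. Every averaged quantity in the flux therefore has no first-order
  term.\<close>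

lemma flux_EC_truncation:
  fixes \<rho> :: "real ^ 'd \<Rightarrow> real" and \<phi> :: "'k::finite \<Rightarrow> real ^ 'd \<Rightarrow> real"
    and Uh :: "real \<Rightarrow> 'k sgstate"
  assumes X: "open X" and Uh: "smooth_on X Uh" and Y: "compact Y" "Y \<subseteq> X"
    and pd: "\<And>x. x \<in> X \<Longrightarrow> pos_def (pc_mat \<rho> \<phi> (fst (Uh x)))"
  obtains c where "eventually (\<lambda>p. norm (flux_EC \<rho> \<phi> g (\<lambda>j. shifted_average Uh (of_int j - 1) p) 0
    - sg_flux \<rho> \<phi> g (Uh (fst p))) \<le> c * (snd p)\<^sup>2) (mesh_filter Y)"
proof -
  let ?F = "mesh_filter Y" and ?P = "pc_mat \<rho> \<phi>"
  let ?E = "quad_expansion ?F snd"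
  let ?L = "shifted_average Uh (-1)" and ?R = "shifted_average Uh 0"
  define U0 where "U0 p = Uh (fst p)" for p :: "real \<times> real"
  define U1 where "U1 p = (1/2) *\<^sub>R vector_derivative Uh (at (fst p))" for p :: "real \<times> real"
  let ?u0 = "\<lambda>p. vel \<rho> \<phi> (U0 p)"
  have L: "?E ?L U0 (\<lambda>p. - U1 p)" and R: "?E ?R U0 U1"
    using quad_expansion_shifted_average[OF X Uh Y, of "-1"] quad_expansion_shifted_average[OF X Uh Y, of 0]
    by (simp_all add: U0_def[abs_def] U1_def[abs_def])
  have fst_cont: "continuous_on (Y \<times> UNIV) (\<lambda>p. fst (Uh (fst p)))"
    using Y(2) by (intro continuous_on_fst
      continuous_on_compose2[OF smooth_on_continuous_on[OF Uh] continuous_on_fst[OF continuous_on_id]]) auto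
  \<comment> \<open>Compactness of \<open>Y\<close> yields one coercivity constant for all base
    points.\<close>
  obtain \<alpha> where \<alpha>: "\<And>y. y \<in> Y \<Longrightarrow> coercive \<alpha> (?P (fst (Uh y)))"
  proof (rule pos_def_coercive_uniform[OF Y(1)])
    show "continuous_on (Y \<times> UNIV) (\<lambda>p. ?P (fst (Uh (fst p))) *v snd p)"
      by (intro pc.continuous_on fst_cont continuous_intros)
  qed (use pd Y(2) in auto)
  then have co: "eventually (\<lambda>p. coercive \<alpha> (?P (fst (U0 p)))) ?F"
    unfolding eventually_mesh_filter U0_def by (intro exI[of _ 1]) auto
  note vel = quad_expansion_vel[OF _ Bfun_snd_mesh_filter tendsto_snd_mesh_filter co]
  note bil = quad_expansion_bilinear[OF bounded_bilinear_pc_mat Bfun_snd_mesh_filter]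
  note bil0 = quad_expansion_bilinear_0[OF bounded_bilinear_pc_mat Bfun_snd_mesh_filter]
  note hL = quad_expansion_linear[OF bounded_linear_fst L]
  note hR = quad_expansion_linear[OF bounded_linear_fst R]
  have h: "?E (\<lambda>p. (1/2) *\<^sub>R (fst (?L p) + fst (?R p))) (\<lambda>p. fst (U0 p)) (\<lambda>_. 0)"
    by (rule quad_expansion_midpoint[OF hL hR]) simp
  have u: "?E (\<lambda>p. (1/2) *\<^sub>R (vel \<rho> \<phi> (?L p) + vel \<rho> \<phi> (?R p))) ?u0 (\<lambda>_. 0)"
    by (rule quad_expansion_midpoint[OF vel[OF L] vel[OF R]]) (simp add: vel_deriv_minus)
  \<comment> \<open>The pressure is an average of products, so each product is expanded before the
    midpoint rule is applied.\<close>
  have hh: "?E (\<lambda>p. (1/2) *\<^sub>R (?P (fst (?L p)) *v fst (?L p) + ?P (fst (?R p)) *v fst (?R p)))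
      (\<lambda>p. ?P (fst (U0 p)) *v fst (U0 p)) (\<lambda>_. 0)"
    by (rule quad_expansion_midpoint[OF bil[OF hL hL] bil[OF hR hR]])
      (simp add: pc.minus_left pc.minus_right)
  note m = bil0[OF h u]
  have p: "?E (\<lambda>p. (g / 2) *\<^sub>R ((1/2) *\<^sub>R (?P (fst (?L p)) *v fst (?L p) + ?P (fst (?R p)) *v fst (?R p))))
      (\<lambda>p. (g / 2) *\<^sub>R (?P (fst (U0 p)) *v fst (U0 p))) (\<lambda>_. 0)"
    using quad_expansion_linear[OF bounded_linear_scaleR_right[of "g / 2"] hh]
    by (simp only: scaleR_zero_right)
  have q: "?E (\<lambda>p. (g / 2) *\<^sub>R ((1/2) *\<^sub>R (?P (fst (?L p)) *v fst (?L p) + ?P (fst (?R p)) *v fst (?R p)))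
        + ?P ((1/2) *\<^sub>R (vel \<rho> \<phi> (?L p) + vel \<rho> \<phi> (?R p))) *v
          (?P ((1/2) *\<^sub>R (fst (?L p) + fst (?R p))) *v ((1/2) *\<^sub>R (vel \<rho> \<phi> (?L p) + vel \<rho> \<phi> (?R p)))))
      (\<lambda>p. (g / 2) *\<^sub>R (?P (fst (U0 p)) *v fst (U0 p)) + ?P (?u0 p) *v (?P (fst (U0 p)) *v ?u0 p)) (\<lambda>_. 0)"
    using quad_expansion_add[OF p bil0[OF u m]] by (simp only: add_0)
  obtain c where c: "eventually (\<lambda>p. norm (flux_EC \<rho> \<phi> g (\<lambda>j. shifted_average Uh (of_int j - 1) p) 0
    - (?P (fst (U0 p)) *v ?u0 p,
       (g / 2) *\<^sub>R (?P (fst (U0 p)) *v fst (U0 p)) + ?P (?u0 p) *v (?P (fst (U0 p)) *v ?u0 p)))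
       \<le> c * (snd p)\<^sup>2) ?F"
    using quad_expansion_bound[OF quad_expansion_Pair[OF m q, folded zero_prod_def]]
    by (auto simp: flux_EC_def Let_def avg_def)
  \<comment> \<open>At an exact state \<open>P(h) u = q\<close>, and commutativity turns
    \<open>P(u) q\<close> into the \<open>P(q) u\<close> of the physical flux.\<close>
  have eq: "(?P (fst U) *v vel \<rho> \<phi> U,
       (g / 2) *\<^sub>R (?P (fst U) *v fst U) + ?P (vel \<rho> \<phi> U) *v (?P (fst U) *v vel \<rho> \<phi> U)) = sg_flux \<rho> \<phi> g U"
    if "pos_def (?P (fst U))" for U
    unfolding sg_flux_def Let_def pc_mat_vel[OF that]
    by (simp add: pc_mat_mult_commute[of \<rho> \<phi> "vel \<rho> \<phi> U" "snd U"] add.commute flip: vel_def)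
  have "eventually (\<lambda>p. pos_def (?P (fst (U0 p)))) ?F"
    unfolding eventually_mesh_filter U0_def using pd Y(2) by (intro exI[of _ 1]) auto
  with c have "eventually (\<lambda>p. norm (flux_EC \<rho> \<phi> g (\<lambda>j. shifted_average Uh (of_int j - 1) p) 0
    - sg_flux \<rho> \<phi> g (Uh (fst p))) \<le> c * (snd p)\<^sup>2) ?F"
    by eventually_elim (simp only: eq U0_def)
  then show thesis by (rule that)
qed

text \<open>The faces lie half a cell on either side of the center, so each single face term is only
  first-order accurate; the errors of the two faces are opposite and cancel in the average.\<close>

lemma source_EC_truncation:
  fixes \<rho> :: "real ^ 'd \<Rightarrow> real" and \<phi> :: "'k::finite \<Rightarrow> real ^ 'd \<Rightarrow> real"
    and Uh :: "real \<Rightarrow> 'k sgstate" and Bh :: "real \<Rightarrow> real ^ 'k"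
  assumes X: "open X" and Uh: "smooth_on X Uh" and Bh: "smooth_on X Bh" and Y: "compact Y" "Y \<subseteq> X"
  obtains c where "eventually (\<lambda>p. norm (source_EC \<rho> \<phi> g (snd p)
      (\<lambda>j. shifted_average Bh (of_int j - 1/2) p) (\<lambda>j. shifted_average Uh (of_int j - 1/2) p) 0
    - sg_source \<rho> \<phi> g (Uh (fst p)) (vector_derivative Bh (at (fst p)))) \<le> c * (snd p)\<^sup>2) (mesh_filter Y)"
proof -
  let ?F = "mesh_filter Y" and ?P = "pc_mat \<rho> \<phi>"
  let ?E = "quad_expansion ?F snd"
  let ?h = "\<lambda>a p. fst (shifted_average Uh a p)" and ?b = "shifted_average Bh"
  define h0 where "h0 p = fst (Uh (fst p))" for p :: "real \<times> real"
  define h1 where "h1 p = (1/2) *\<^sub>R fst (vector_derivative Uh (at (fst p)))" for p :: "real \<times> real"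
  define b1 where "b1 x = vector_derivative Bh (at x)" for x
  define b2 where "b2 p = (1/2) *\<^sub>R vector_derivative b1 (at (fst p))" for p :: "real \<times> real"
  note bil = quad_expansion_bilinear[OF bounded_bilinear_pc_mat Bfun_snd_mesh_filter]
  have h: "?E (?h a) h0 (\<lambda>p. (2 * a + 1) *\<^sub>R h1 p)" if "-2 \<le> a" "a \<le> 1" for a
    using quad_expansion_linear[OF bounded_linear_fst quad_expansion_shifted_average[OF X Uh Y that]]
    by (simp add: h0_def[abs_def] h1_def[abs_def] add_divide_distrib)
  have hbar: "?E (\<lambda>p. (1/2) *\<^sub>R (?h a p + ?h (a + 1) p)) h0 (\<lambda>p. (2 * a + 2) *\<^sub>R h1 p)"
    if "-2 \<le> a" "a \<le> 0" for a
  proof -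
    have "(\<lambda>p. (1/2) *\<^sub>R (h0 p + h0 p)) = h0" by (simp flip: scaleR_2)
    moreover have "(1/2) *\<^sub>R ((2 * a + 1) *\<^sub>R h1 p + (2 * (a + 1) + 1) *\<^sub>R h1 p) = (2 * a + 2) *\<^sub>R h1 p" for p
      by (simp add: add_divide_distrib flip: scaleR_add_left)
    ultimately show ?thesis
      using quad_expansion_linear[OF bounded_linear_scaleR_right[of "1/2"]
          quad_expansion_add[OF h[of a] h[of "a + 1"]]] that by simp
  qed
  have jmp: "?E (\<lambda>p. (1 / snd p) *\<^sub>R (?b (a + 1) p - ?b a p)) (\<lambda>p. b1 (fst p)) (\<lambda>p. (2 * a + 2) *\<^sub>R b2 p)"
    if "-2 \<le> a" "a \<le> 0" for a
    using quad_expansion_shifted_average_jump[OF X Bh Y that]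
    by (simp add: b1_def[abs_def] b2_def[abs_def] add_divide_distrib)
  have prod: "?E (\<lambda>p. ?P ((1/2) *\<^sub>R (?h a p + ?h (a + 1) p)) *v ((1 / snd p) *\<^sub>R (?b (a + 1) p - ?b a p)))
      (\<lambda>p. ?P (h0 p) *v b1 (fst p))
      (\<lambda>p. ?P (h0 p) *v ((2 * a + 2) *\<^sub>R b2 p) + ?P ((2 * a + 2) *\<^sub>R h1 p) *v b1 (fst p))"
    if "-2 \<le> a" "a \<le> 0" for a
    by (rule bil[OF hbar[OF that] jmp[OF that]])
  let ?S = "\<lambda>p. ?P ((1/2) *\<^sub>R (?h (-1/2) p + ?h (1/2) p)) *v ((1 / snd p) *\<^sub>R (?b (1/2) p - ?b (-1/2) p))
      + ?P ((1/2) *\<^sub>R (?h (-3/2) p + ?h (-1/2) p)) *v ((1 / snd p) *\<^sub>R (?b (-1/2) p - ?b (-3/2) p))"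
  \<comment> \<open>The offsets -1/2 and -3/2 give \<open>2 * a + 2\<close> the values 1 and
    -1.\<close>
  have "?E (\<lambda>p. (1/2) *\<^sub>R ?S p) (\<lambda>p. ?P (h0 p) *v b1 (fst p)) (\<lambda>_. 0)"
    using quad_expansion_midpoint[OF prod[of "-1/2"] prod[of "-3/2"]]
    by (simp add: pc.minus_left pc.minus_right)
  from quad_expansion_linear[OF bounded_linear_scaleR_right[of "- g"] this]
  have S: "?E (\<lambda>p. - g *\<^sub>R ((1/2) *\<^sub>R ?S p)) (\<lambda>p. - g *\<^sub>R (?P (h0 p) *v b1 (fst p))) (\<lambda>_. 0)"
    by simp
  obtain c where c: "eventually (\<lambda>p. norm (- g *\<^sub>R ((1/2) *\<^sub>R ?S p) - - g *\<^sub>R (?P (h0 p) *v b1 (fst p)))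
      \<le> c * (snd p)\<^sup>2) ?F"
    using quad_expansion_bound[OF S] .
  have eq: "source_EC \<rho> \<phi> g (snd p) (\<lambda>j. ?b (of_int j - 1/2) p) (\<lambda>j. shifted_average Uh (of_int j - 1/2) p) 0
      - sg_source \<rho> \<phi> g (Uh (fst p)) (vector_derivative Bh (at (fst p)))
      = (0, - g *\<^sub>R ((1/2) *\<^sub>R ?S p) - - g *\<^sub>R (?P (h0 p) *v b1 (fst p)))" for p
    by (simp add: source_EC_def sg_source_def Let_def avg_def jump_def h0_def b1_def pc.scaleR_right
        flip: scaleR_add_right)
  have "eventually (\<lambda>p. norm (source_EC \<rho> \<phi> g (snd p) (\<lambda>j. ?b (of_int j - 1/2) p)
        (\<lambda>j. shifted_average Uh (of_int j - 1/2) p) 0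
      - sg_source \<rho> \<phi> g (Uh (fst p)) (vector_derivative Bh (at (fst p)))) \<le> c * (snd p)\<^sup>2) ?F"
    using c by (simp only: eq norm_Pair1)
  then show thesis by (rule that)
qed

section \<open>Passing from mesh cells to shifted averages\<close>

lemma cell_average_interface:
  "cell_average x0 dx f (i + j) = shifted_average f (of_int j - 1) (interface_pt x0 dx i, dx)"
  by (simp add: cell_average_def shifted_average_def interface_pt_def algebra_simps)

lemma cell_average_center:
  "cell_average x0 dx f (i + j) = shifted_average f (of_int j - 1/2) (cell_center x0 dx i, dx)"
  by (simp add: cell_average_def shifted_average_def interface_pt_def cell_center_def algebra_simps)

text \<open>Translation invariance of the stencil allows the truncation estimates to be stated at
  index 0 only.\<close>

lemma flux_EC_shift: "flux_EC \<rho> \<phi> g U i = flux_EC \<rho> \<phi> g (\<lambda>j. U (i + j)) 0"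
  by (simp add: flux_EC_def avg_def)

lemma source_EC_shift:
  "source_EC \<rho> \<phi> g dx B U i = source_EC \<rho> \<phi> g dx (\<lambda>j. B (i + j)) (\<lambda>j. U (i + j)) 0"
  by (simp add: source_EC_def avg_def jump_def)

lemma second_order_truncation_EC:
  fixes \<rho> :: "real ^ 'd \<Rightarrow> real" and \<phi> :: "'k::finite \<Rightarrow> real ^ 'd \<Rightarrow> real"
  shows "second_order_truncation \<rho> \<phi> g (flux_EC \<rho> \<phi> g) (source_EC \<rho> \<phi> g)"
  unfolding second_order_truncation_def
proof (intro allI impI, elim conjE)
  fix X Y and Uh :: "real \<Rightarrow> 'k sgstate" and Bh :: "real \<Rightarrow> real ^ 'k"
  assume X: "open X" and Uh: "smooth_on X Uh" and Bh: "smooth_on X Bh"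
    and pd: "\<forall>x\<in>X. pos_def (pc_mat \<rho> \<phi> (fst (Uh x)))" and Y: "compact Y" "Y \<subseteq> X"
  obtain c where "eventually (\<lambda>p. norm (flux_EC \<rho> \<phi> g (\<lambda>j. shifted_average Uh (of_int j - 1) p) 0
      - sg_flux \<rho> \<phi> g (Uh (fst p))) \<le> c * (snd p)\<^sup>2) (mesh_filter Y)"
    by (rule flux_EC_truncation[OF X Uh Y]) (use pd in auto)
  moreover obtain d where "eventually (\<lambda>p. norm (source_EC \<rho> \<phi> g (snd p)
      (\<lambda>j. shifted_average Bh (of_int j - 1/2) p) (\<lambda>j. shifted_average Uh (of_int j - 1/2) p) 0
      - sg_source \<rho> \<phi> g (Uh (fst p)) (vector_derivative Bh (at (fst p)))) \<le> d * (snd p)\<^sup>2) (mesh_filter Y)"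
    by (rule source_EC_truncation[OF X Uh Bh Y])
  ultimately have "eventually (\<lambda>p. norm (flux_EC \<rho> \<phi> g (\<lambda>j. shifted_average Uh (of_int j - 1) p) 0
      - sg_flux \<rho> \<phi> g (Uh (fst p))) \<le> max c d * (snd p)\<^sup>2 \<and>
      norm (source_EC \<rho> \<phi> g (snd p)
      (\<lambda>j. shifted_average Bh (of_int j - 1/2) p) (\<lambda>j. shifted_average Uh (of_int j - 1/2) p) 0
      - sg_source \<rho> \<phi> g (Uh (fst p)) (vector_derivative Bh (at (fst p)))) \<le> max c d * (snd p)\<^sup>2) (mesh_filter Y)"
    by eventually_elim (auto intro: order_trans[OF _ mult_right_mono])
  \<comment> \<open>The threshold is common to all points of \<open>Y\<close>, hence independent of
    the mesh origin and of the cell index.\<close>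
  then obtain \<delta> where \<delta>: "\<delta> > 0" "\<And>y \<epsilon>. y \<in> Y \<Longrightarrow> 0 < \<epsilon> \<Longrightarrow> \<epsilon> < \<delta> \<Longrightarrow>
      norm (flux_EC \<rho> \<phi> g (\<lambda>j. shifted_average Uh (of_int j - 1) (y, \<epsilon>)) 0
      - sg_flux \<rho> \<phi> g (Uh y)) \<le> max c d * \<epsilon>\<^sup>2 \<and>
      norm (source_EC \<rho> \<phi> g \<epsilon>
      (\<lambda>j. shifted_average Bh (of_int j - 1/2) (y, \<epsilon>)) (\<lambda>j. shifted_average Uh (of_int j - 1/2) (y, \<epsilon>)) 0
      - sg_source \<rho> \<phi> g (Uh y) (vector_derivative Bh (at y))) \<le> max c d * \<epsilon>\<^sup>2"
    unfolding eventually_mesh_filter by auto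
  have fl: "norm (flux_EC \<rho> \<phi> g (cell_average x0 dx Uh) i - sg_flux \<rho> \<phi> g (Uh (interface_pt x0 dx i)))
      \<le> max c d * dx\<^sup>2" if "0 < dx" "dx < \<delta>" "interface_pt x0 dx i \<in> Y" for x0 dx i
    using \<delta>(2)[OF that(3,1,2)] unfolding flux_EC_shift[of _ _ _ _ i] cell_average_interface by blast
  have "norm (source_EC \<rho> \<phi> g dx (cell_average x0 dx Bh) (cell_average x0 dx Uh) i
      - sg_source \<rho> \<phi> g (Uh (cell_center x0 dx i)) (vector_derivative Bh (at (cell_center x0 dx i))))
      \<le> max c d * dx\<^sup>2" if "0 < dx" "dx < \<delta>" "cell_center x0 dx i \<in> Y" for x0 dx i
    using \<delta>(2)[OF that(3,1,2)] unfolding source_EC_shift[of _ _ _ _ _ _ i] cell_average_center by blast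
  with fl \<delta>(1) show "\<exists>c \<delta>. \<delta> > 0 \<and>
            (\<forall>x0 dx i. 0 < dx \<and> dx < \<delta> \<longrightarrow>
              (let U = cell_average x0 dx Uh; B = cell_average x0 dx Bh;
                   y = interface_pt x0 dx i; z = cell_center x0 dx i in
                (y \<in> Y \<longrightarrow> norm (flux_EC \<rho> \<phi> g U i - sg_flux \<rho> \<phi> g (Uh y)) \<le> c * dx\<^sup>2) \<and>
                (z \<in> Y \<longrightarrow> norm (source_EC \<rho> \<phi> g dx B U i
                    - sg_source \<rho> \<phi> g (Uh z) (vector_derivative Bh (at z))) \<le> c * dx\<^sup>2)))"
    unfolding Let_def by blast
qed

theorem theorem4p1:
  fixes M :: "'w measure" and \<xi> :: "'w \<Rightarrow> real ^ 'd"
    and \<rho> :: "real ^ 'd \<Rightarrow> real"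
    and \<phi> :: "'k::finite \<Rightarrow> real ^ 'd \<Rightarrow> real" and k1 :: 'k
    and g :: real
  assumes "prob_space M"
    and "\<rho> \<in> borel_measurable borel" and "\<And>y. \<rho> y \<ge> 0"
    and "distributed M lborel \<xi> (\<lambda>y. ennreal (\<rho> y))"
    and "\<And>p. real_polynomial_function p \<Longrightarrow> integrable lborel (\<lambda>y. p y * \<rho> y)"
    and "\<And>k. real_polynomial_function (\<phi> k)"
    and "\<phi> k1 = (\<lambda>y. 1)"
    and "\<And>k l. ip_rho \<rho> (\<phi> k) (\<phi> l) = (if k = l then 1 else 0)"
    and "g > 0"
  shows "well_balanced \<rho> \<phi> (flux_EC \<rho> \<phi> g) (source_EC \<rho> \<phi> g)
    \<and> energy_conservative \<rho> \<phi> g (flux_EC \<rho> \<phi> g) (source_EC \<rho> \<phi> g)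
    \<and> second_order_truncation \<rho> \<phi> g (flux_EC \<rho> \<phi> g) (source_EC \<rho> \<phi> g)"
  using well_balanced_EC energy_conservative_EC second_order_truncation_EC by blast

end
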